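(* Let $\mathbb{I}\subset\mathbb{H}$ be the icosian ring. Then $\mathcal{S}_1(\mathbb{I})$ is finite of cardinality $120$ and realises the $600$-cell $H_4$ (its elements are the vertices of a $600$-cell and form the root system $H_4$). The axis shell satisfies $\mathcal{A}(\mathbb{I})=\mathcal{S}_1(\mathbb{I}^{\,2})$ and is the non-crystallographic root-shell system $H_4\oplus H_4$ over $\mathbb{Z}[\varphi]$, of cardinality $240$, whose convex hull is the $600$-cell tegum.
   Context: $\varphi=(1+\sqrt5)/2$. $\mathbb{H}$ is the real quaternion algebra with norm $N(a+bi+cj+dk)=a^2+b^2+c^2+d^2$, viewed as Euclidean $\mathbb{R}^4$. The icosian ring $\mathbb{I}$ is the free $\mathbb{Z}[\varphi]$-module with basis $\{1,\ i,\ (1+i+j+k)/2,\ (-1+(\varphi-1)i-\varphi j)/2\}$, a subring of $\mathbb{H}$. $\mathcal{S}_1(\mathbb{I})=\{x\in\mathbb{I}:N(x)=1\}$; the integral plane is $\mathbb{I}^2=\mathbb{I}\oplus\mathbb{I}\subset\mathbb{H}^2$ with $Q(x,y)=N(x)+N(y)$ and $\mathcal{S}_1(\mathbb{I}^2)=\{(x,y)\in\mathbb{I}^2:Q(x,y)=1\}$; the axis shell is $\mathcal{A}(\mathbb{I})=(\mathcal{S}_1(\mathbb{I})\times\{0\})\cup(\{0\}\times\mathcal{S}_1(\mathbb{I}))$. $\mathbb{H}^2\cong\mathbb{R}^8$ carries the Euclidean structure with squared norm $Q$. A root-shell system over a ring $R\subset\mathbb{R}$ is a finite subset $T$ of a Euclidean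 space $V$ such that (R1) $T=-T$; (R2) $T$ lies on a single sphere $\{x: \mathcal N(x)=1\}$ for the Euclidean (squared) norm $\mathcal N$, so all elements have the same length; (R3) for each $\alpha\in T$ the reflection $r_\alpha(x)=x-\frac{2\langle x,\alpha\rangle}{\langle\alpha,\alpha\rangle}\alpha$ preserves $T$; (R4) the Cartan coefficients $\frac{2\langle\alpha,\beta\rangle}{\langle\alpha,\alpha\rangle}$ lie in $R$ for all $\alpha,\beta\in T$. For $R=\mathbb{Z}[\varphi]$ it is called non-crystallographic if some Cartan coefficient is not in $\mathbb{Z}$. $H_4$ is the (unit-length) root system of the Coxeter group $H_4$, the $120$ vertices of the $600$-cell $\{3,3,5\}$. $H_4\oplus H_4$ is the orthogonal direct sum of two copies, i.e. $(T\times\{0\})\cup(\{0\}\times T)$ for $T$ of type $H_4$. For polytopes $P_1\subset V_1$, $P_2\subset V_2$ the free sum (tegum) is $P_1\oplus P_2=\mathrm{conv}\big((P_1\times\{0\})\cup(\{0\}\times P_2)\big)\subset V_1\oplus V_2$ with $V_1\perp V_2$; the $600$-cell tegum is the free sum of a $600$-cell with itself. *)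

theory Defs
  imports "HOL-Analysis.Analysis"
begin

section \<open>The golden ring\<close>

definition golden :: real
  where "golden = (1 + sqrt 5) / 2"

definition Zphi :: "real set"
  where "Zphi = {of_int m + of_int n * golden | m n. True}"

definition real_subring :: "real set \<Rightarrow> bool"
  where "real_subring R \<longleftrightarrow> 1 \<in> R \<and> (\<forall>x\<in>R. \<forall>y\<in>R. x - y \<in> R \<and> x * y \<in> R)"


section \<open>Quaternions and the icosian ring\<close>

text \<open>The quaternion a + b i + c j + d k is the vector (a, b, c, d) of Euclidean 4-space.
  The multiplication of the algebra is \<open>qmult\<close>; the instance of \<open>*\<close> on
  \<open>real^4\<close> is the componentwise product and plays no role here.\<close>

type_synonym quat = "real^4"

abbreviation quat :: "real \<Rightarrow> real \<Rightarrow> real \<Rightarrow> real \<Rightarrow> quat"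
  where "quat a b c d \<equiv> vector [a, b, c, d]"

lemma quat_nth [simp]:
  "quat a b c d $ 1 = a" "quat a b c d $ 2 = b" "quat a b c d $ 3 = c" "quat a b c d $ 4 = d"
  by (simp_all add: vector_def)

definition qmult :: "quat \<Rightarrow> quat \<Rightarrow> quat"
  where "qmult x y = quat
    (x$1 * y$1 - x$2 * y$2 - x$3 * y$3 - x$4 * y$4)
    (x$1 * y$2 + x$2 * y$1 + x$3 * y$4 - x$4 * y$3)
    (x$1 * y$3 - x$2 * y$4 + x$3 * y$1 + x$4 * y$2)
    (x$1 * y$4 + x$2 * y$3 - x$3 * y$2 + x$4 * y$1)"

definition qnorm :: "quat \<Rightarrow> real"
  where "qnorm x = (x$1)\<^sup>2 + (x$2)\<^sup>2 + (x$3)\<^sup>2 + (x$4)\<^sup>2"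

lemma qnorm_eq_norm: "qnorm x = (norm x)\<^sup>2"
  unfolding power2_norm_eq_inner by (simp add: qnorm_def inner_vec_def sum_4 power2_eq_square)

definition icosian_comb :: "real \<Rightarrow> real \<Rightarrow> real \<Rightarrow> real \<Rightarrow> quat"
  where "icosian_comb a b c d =
    a *\<^sub>R quat 1 0 0 0 + b *\<^sub>R quat 0 1 0 0 + c *\<^sub>R quat (1/2) (1/2) (1/2) (1/2)
      + d *\<^sub>R quat (-1/2) ((golden - 1) / 2) (- golden / 2) 0"

definition icosians :: "quat set"
  where "icosians = {icosian_comb a b c d | a b c d.
    a \<in> Zphi \<and> b \<in> Zphi \<and> c \<in> Zphi \<and> d \<in> Zphi}"

definition unit_shell :: "quat set \<Rightarrow> quat set"
  where "unit_shell X = {x \<in> X. qnorm x = 1}"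

definition plane_norm :: "quat \<times> quat \<Rightarrow> real"
  where "plane_norm p = qnorm (fst p) + qnorm (snd p)"

lemma plane_norm_eq_norm: "plane_norm p = (norm p)\<^sup>2"
  by (simp add: plane_norm_def qnorm_eq_norm norm_prod_def)

definition plane_unit_shell :: "quat set \<Rightarrow> (quat \<times> quat) set"
  where "plane_unit_shell X = {p \<in> X \<times> X. plane_norm p = 1}"

definition axis_shell :: "quat set \<Rightarrow> (quat \<times> quat) set"
  where "axis_shell X = unit_shell X \<times> {0} \<union> {0} \<times> unit_shell X"


section \<open>Root-shell systems\<close>

definition reflection :: "'a::euclidean_space \<Rightarrow> 'a \<Rightarrow> 'a"
  where "reflection \<alpha> x = x - (2 * (x \<bullet> \<alpha>) / (\<alpha> \<bullet> \<alpha>)) *\<^sub>R \<alpha>"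

definition cartan_coeff :: "'a::euclidean_space \<Rightarrow> 'a \<Rightarrow> real"
  where "cartan_coeff \<alpha> \<beta> = 2 * (\<alpha> \<bullet> \<beta>) / (\<alpha> \<bullet> \<alpha>)"

definition root_shell_system :: "real set \<Rightarrow> 'a::euclidean_space set \<Rightarrow> bool"
  where "root_shell_system R T \<longleftrightarrow>
    real_subring R \<and>
    finite T \<and>
    T = uminus ` T \<and>
    (\<forall>\<alpha>\<in>T. (norm \<alpha>)\<^sup>2 = 1) \<and>
    (\<forall>\<alpha>\<in>T. reflection \<alpha> ` T = T) \<and>
    (\<forall>\<alpha>\<in>T. \<forall>\<beta>\<in>T. cartan_coeff \<alpha> \<beta> \<in> R)"

definition noncrystallographic :: "'a::euclidean_space set \<Rightarrow> bool"
  where "noncrystallographic T \<longleftrightarrow> (\<exists>\<alpha>\<in>T. \<exists>\<beta>\<in>T. cartan_coeff \<alpha> \<beta> \<notin> \<int>)"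


section \<open>The root system of type H4\<close>

text \<open>The orbit of the simple roots a 0, ..., a (n - 1) under the group generated by the
  reflections in them.\<close>

inductive_set root_orbit :: "(nat \<Rightarrow> 'a::euclidean_space) \<Rightarrow> nat \<Rightarrow> 'a set"
  for a :: "nat \<Rightarrow> 'a" and n :: nat where
    simple: "i < n \<Longrightarrow> a i \<in> root_orbit a n"
  | reflect: "x \<in> root_orbit a n \<Longrightarrow> i < n \<Longrightarrow> reflection (a i) x \<in> root_orbit a n"

text \<open>The unit-length root system of the Coxeter group with Coxeter matrix m of rank n:
  the orbit of simple roots that meet at the angles \<open>pi - pi / m i j\<close>. Since
  \<open>m i i = 1\<close>, the case \<open>i = j\<close> says that they are unit vectors. Only finite labels m i j are covered.\<close>

definition coxeter_root_system :: "nat \<Rightarrow> (nat \<Rightarrow> nat \<Rightarrow> nat) \<Rightarrow> 'a::euclidean_space set \<Rightarrow> bool"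
  where "coxeter_root_system n m T \<longleftrightarrow>
    (\<exists>a. (\<forall>i<n. \<forall>j<n. a i \<bullet> a j = - cos (pi / real (m i j))) \<and> T = root_orbit a n)"

text \<open>The Coxeter diagram is the path 0 - 1 - 2 - 3 whose last edge is labelled 5.\<close>

definition H4_matrix :: "nat \<Rightarrow> nat \<Rightarrow> nat"
  where "H4_matrix i j =
    (if i = j then 1
     else if {i, j} = {0, 1} \<or> {i, j} = {1, 2} then 3
     else if {i, j} = {2, 3} then 5
     else 2)"

definition H4_root_system :: "'a::euclidean_space set \<Rightarrow> bool"
  where "H4_root_system T \<longleftrightarrow> coxeter_root_system 4 H4_matrix T"

definition H4_sum_H4_root_system :: "('a::euclidean_space \<times> 'a) set \<Rightarrow> bool"
  where "H4_sum_H4_root_system A \<longleftrightarrow>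
    (\<exists>T. H4_root_system T \<and> A = T \<times> {0} \<union> {0} \<times> T)"


section \<open>Regular convex polytopes and the 600-cell\<close>

definition polytope_vertices :: "'a::euclidean_space set \<Rightarrow> 'a set"
  where "polytope_vertices P = {v. v extreme_point_of P}"

text \<open>A flag lists its faces of dimensions 0, ..., dim P - 1.\<close>

definition is_flag :: "'a::euclidean_space set \<Rightarrow> 'a set list \<Rightarrow> bool"
  where "is_flag P Fs \<longleftrightarrow>
    int (length Fs) = aff_dim P \<and>
    (\<forall>k<length Fs. Fs ! k face_of P \<and> aff_dim (Fs ! k) = int k) \<and>
    (\<forall>k. Suc k < length Fs \<longrightarrow> Fs ! k \<subseteq> Fs ! Suc k)"

definition polytope_symmetry :: "'a::euclidean_space set \<Rightarrow> ('a \<Rightarrow> 'a) \<Rightarrow> bool"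
  where "polytope_symmetry P f \<longleftrightarrow> (\<forall>x y. dist (f x) (f y) = dist x y) \<and> f ` P = P"

definition regular_polytope :: "'a::euclidean_space set \<Rightarrow> bool"
  where "regular_polytope P \<longleftrightarrow>
    polytope P \<and>
    (\<forall>Fs Gs. is_flag P Fs \<and> is_flag P Gs \<longrightarrow>
      (\<exists>f. polytope_symmetry P f \<and> map (image f) Fs = Gs))"

text \<open>The Schlaefli symbol [p0, ..., p(d-2)] of a polytope of dimension d. Entry k says that the
  section between a face of dimension k - 1 and an incident face of dimension k + 2 is a polygon
  with \<open>ps ! k\<close> vertices, i.e. that \<open>ps ! k\<close> faces of dimension k lie between the two.
  The empty face has dimension -1, and P is a face of itself. For [p, q, r]: each 2-face has p
  vertices, each vertex of a cell is on q edges of that cell, each edge is on r 2-faces of P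
  (equivalently, on r cells).\<close>

definition has_schlaefli_symbol :: "'a::euclidean_space set \<Rightarrow> nat list \<Rightarrow> bool"
  where "has_schlaefli_symbol P ps \<longleftrightarrow>
    aff_dim P = int (length ps) + 1 \<and>
    (\<forall>k<length ps. \<forall>F G.
      F face_of P \<and> G face_of P \<and> F \<subseteq> G \<and> aff_dim F = int k - 1 \<and> aff_dim G = int k + 2 \<longrightarrow>
      card {H. H face_of P \<and> F \<subseteq> H \<and> H \<subseteq> G \<and> aff_dim H = int k} = ps ! k)"

definition is_600_cell :: "'a::euclidean_space set \<Rightarrow> bool"
  where "is_600_cell P \<longleftrightarrow> regular_polytope P \<and> has_schlaefli_symbol P [3, 3, 5]"

definition free_sum :: "'a::euclidean_space set \<Rightarrow> 'b::euclidean_space set \<Rightarrow> ('a \<times> 'b) set"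
  where "free_sum P Q = convex hull (P \<times> {0} \<union> {0} \<times> Q)"


section \<open>The icosians form a subring, free over the golden ring\<close>

lemma golden_sq: "golden * golden = golden + 1"
proof -
  have "sqrt 5 * sqrt 5 = (5::real)" by simp
  then show ?thesis by (simp add: golden_def field_simps)
qed

lemma Zphi_int: "of_int m \<in> Zphi"
  unfolding Zphi_def by (rule CollectI, rule exI[of _ m], rule exI[of _ 0]) simp

lemma Zphi_golden: "golden \<in> Zphi"
  unfolding Zphi_def by (rule CollectI, rule exI[of _ 0], rule exI[of _ 1]) simp

lemma Zphi_diff: "x \<in> Zphi \<Longrightarrow> y \<in> Zphi \<Longrightarrow> x - y \<in> Zphi"
  unfolding Zphi_def
proof safe
  fix m n m' n' :: int
  show "\<exists>p q. of_int m + of_int n * golden - (of_int m' + of_int n' * golden)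
      = of_int p + of_int q * golden \<and> True"
    by (rule exI[of _ "m - m'"], rule exI[of _ "n - n'"]) (simp add: algebra_simps)
qed

lemma Zphi_mult: "x \<in> Zphi \<Longrightarrow> y \<in> Zphi \<Longrightarrow> x * y \<in> Zphi"
  unfolding Zphi_def
proof safe
  fix m n m' n' :: int
  have "(of_int m + of_int n * golden) * (of_int m' + of_int n' * golden)
      = of_int m * of_int m' + (of_int m * of_int n' + of_int n * of_int m') * golden
        + of_int n * of_int n' * (golden * golden)"
    by (simp add: algebra_simps)
  then have "(of_int m + of_int n * golden) * (of_int m' + of_int n' * golden)
      = of_int (m * m' + n * n') + of_int (m * n' + n * m' + n * n') * golden"
    by (simp add: golden_sq algebra_simps)
  then show "\<exists>p q. (of_int m + of_int n * golden) * (of_int m' + of_int n' * golden)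
      = of_int p + of_int q * golden \<and> True"
    by blast
qed

lemma Zphi_add: "x \<in> Zphi \<Longrightarrow> y \<in> Zphi \<Longrightarrow> x + y \<in> Zphi"
  using Zphi_diff[of x "0 - y"] Zphi_diff[of 0 y] Zphi_int[of 0] by simp

lemma real_subring_Zphi: "real_subring Zphi"
  using Zphi_int[of 1] by (simp add: real_subring_def Zphi_diff Zphi_mult)

lemma icosian_comb_eq: "icosian_comb a b c d = quat
    (a + c / 2 - d / 2) (b + c / 2 + d * (golden - 1) / 2) (c / 2 - d * golden / 2) (c / 2)"
  by (simp add: icosian_comb_def vec_eq_iff forall_4)

lemma icosian_comb_inject:
  "icosian_comb a b c d = icosian_comb a' b' c' d' \<longleftrightarrow> a = a' \<and> b = b' \<and> c = c' \<and> d = d'"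
proof -
  have "golden > 0" by (simp add: golden_def add_pos_pos)
  then show ?thesis by (auto simp: icosian_comb_eq vec_eq_iff forall_4)
qed

lemma icosiansI:
  "a \<in> Zphi \<Longrightarrow> b \<in> Zphi \<Longrightarrow> c \<in> Zphi \<Longrightarrow> d \<in> Zphi \<Longrightarrow> icosian_comb a b c d \<in> icosians"
  unfolding icosians_def by blast

lemma icosiansE:
  assumes "x \<in> icosians"
  obtains a b c d where "x = icosian_comb a b c d"
    "a \<in> Zphi" "b \<in> Zphi" "c \<in> Zphi" "d \<in> Zphi"
  using assms unfolding icosians_def by blast

lemma icosians_diff:
  assumes "x \<in> icosians" "y \<in> icosians"
  shows "x - y \<in> icosians"
proof -
  obtain a b c d where x: "x = icosian_comb a b c d"
    "a \<in> Zphi" "b \<in> Zphi" "c \<in> Zphi" "d \<in> Zphi"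
    using assms(1) by (rule icosiansE)
  obtain a' b' c' d' where y: "y = icosian_comb a' b' c' d'"
    "a' \<in> Zphi" "b' \<in> Zphi" "c' \<in> Zphi" "d' \<in> Zphi"
    using assms(2) by (rule icosiansE)
  have "x - y = icosian_comb (a - a') (b - b') (c - c') (d - d')"
    unfolding x(1) y(1) icosian_comb_def scaleR_diff_left by simp
  then show ?thesis using x y by (simp add: icosiansI Zphi_diff)
qed

lemma icosians_one: "quat 1 0 0 0 \<in> icosians"
proof -
  have "quat 1 0 0 0 = icosian_comb 1 0 0 0" by (simp add: icosian_comb_def)
  then show ?thesis using icosiansI[of 1 0 0 0] Zphi_int[of 0] Zphi_int[of 1] by simp
qed

lemma icosians_mult:
  assumes "x \<in> icosians" "y \<in> icosians"
  shows "qmult x y \<in> icosians"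
proof -
  obtain a b c d where x: "x = icosian_comb a b c d"
    and xc: "a \<in> Zphi" "b \<in> Zphi" "c \<in> Zphi" "d \<in> Zphi"
    using assms(1) by (rule icosiansE)
  obtain a' b' c' d' where y: "y = icosian_comb a' b' c' d'"
    and yc: "a' \<in> Zphi" "b' \<in> Zphi" "c' \<in> Zphi" "d' \<in> Zphi"
    using assms(2) by (rule icosiansE)
  define p where "p = a * a'
        + of_int (-1) * (b * b')
        + (of_int (-2) + of_int (1) * golden) * (b * c')
        + (of_int (1) + of_int (-1) * golden) * (c * b')
        + of_int (-1) * (c * c')
        + (of_int (-1) + of_int (1) * golden) * (c * d')
        + (of_int (1) + of_int (-1) * golden) * (d * b')
        + (of_int (2) + of_int (-1) * golden) * (d * c')
        + of_int (-1) * (d * d')"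
  define q where "q = a * b'
        + b * a'
        + (of_int (-2) + of_int (1) * golden) * (b * c')
        + (of_int (-1) + of_int (1) * golden) * (b * d')
        + (of_int (3) + of_int (-1) * golden) * (c * b')
        + (of_int (-2) + of_int (2) * golden) * (c * d')
        + of_int (-1) * golden * (d * b')
        + (of_int (2) + of_int (-2) * golden) * (d * c')"
  define r where "r = a * c'
        + b * c'
        + of_int (-1) * golden * (b * d')
        + c * a'
        + of_int (-1) * (c * b')
        + c * c'
        + of_int (-1) * golden * (c * d')
        + of_int (1) * golden * (d * b')
        + (of_int (-1) + of_int (1) * golden) * (d * c')"
  define s where "s = a * d'
        + (of_int (-2) + of_int (2) * golden) * (b * c')
        + of_int (-1) * (b * d')
        + (of_int (2) + of_int (-2) * golden) * (c * b')
        + (of_int (-2) + of_int (1) * golden) * (c * d')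
        + d * a'
        + d * b'
        + (of_int (3) + of_int (-1) * golden) * (d * c')
        + of_int (-1) * (d * d')"
  have red: "golden * (golden * t) = golden * t + t" for t
    using golden_sq by (simp add: mult.assoc[symmetric] distrib_right)
  have "qmult x y = icosian_comb p q r s"
    unfolding x y icosian_comb_eq vec_eq_iff forall_4 qmult_def quat_nth p_def q_def r_def s_def
    by (simp add: field_simps red golden_sq)
  moreover have "p \<in> Zphi" "q \<in> Zphi" "r \<in> Zphi" "s \<in> Zphi"
    unfolding p_def q_def r_def s_def
    by (intro Zphi_add Zphi_mult Zphi_int Zphi_golden xc yc)+
  ultimately show ?thesis by (simp add: icosiansI)
qed

end

theory Submission
  imports Defs
begin

text \<open>
  The theorem splits into arithmetic, which finds the 120 unit icosians, and geometry, which
  recovers the whole face structure of their convex hull from the reflections.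

  Arithmetic. Twice an icosian has coordinates \<open>p + q \<phi>\<close> with integers \<open>p\<close>, \<open>q\<close>, subject only to
  four parity conditions (\<open>icosians_eq\<close>), and \<open>4 N\<close> is \<open>\<Sum>(p\<^sup>2 + q\<^sup>2) + (\<Sum>(2 p q + q\<^sup>2)) \<phi>\<close>.
  Since \<open>\<phi>\<close> is irrational, norm one means that eight integers have square sum 4 and that the
  second sum vanishes: a finite problem with exactly 120 solutions. The positivity of the first
  sum also settles the axis shell. If \<open>N(x) + N(y) = 1\<close> and \<open>N(x) = m + n \<phi>\<close>,
  \<open>N(y) = m' + n' \<phi>\<close>, then \<open>4 m\<close> and \<open>4 m'\<close> are such square sums, so \<open>m\<close> and \<open>m'\<close> are nonnegative
  integers with sum 1; one of them is 0, and the quaternion with that norm vanishes. Finally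
  \<open>2 \<langle>x, y\<rangle>\<close> lies in \<open>\<int>[\<phi>]\<close> for icosians, so the unit icosians are closed under
  the reflections in each other and have Cartan coefficients in \<open>\<int>[\<phi>]\<close>.

  Geometry. This is Wythoff's construction read backwards. Let \<open>a\<^sub>0, ..., a\<^sub>n\<^sub>-\<^sub>1\<close> be simple roots
  whose reflections preserve a finite set \<open>V\<close> of unit vectors, and let \<open>v\<^sub>0, ..., v\<^sub>n\<^sub>-\<^sub>1\<close> be points of
  \<open>V\<close> such that the reflection in \<open>a\<^sub>i\<close> swaps \<open>v\<^sub>i\<close> and \<open>v\<^sub>i\<^sub>+\<^sub>1\<close> and fixes the other \<open>v\<^sub>j\<close>; for
  \<open>i = n - 1\<close> it moves \<open>v\<^sub>n\<^sub>-\<^sub>1\<close> out of the chain.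
  The partial sums \<open>v\<^sub>0 + ... + v\<^sub>k\<close> are then, up to scaling, the fundamental weights. Assume that
  on \<open>V\<close> the \<open>k\<close>-th of them is largest exactly at \<open>v\<^sub>0, ..., v\<^sub>k\<close>. The reflection group \<open>W\<close> moves any
  linear functional into the fundamental chamber, where it is a nonnegative combination of the
  weights; so the set where it is largest on \<open>V\<close> is an initial segment \<open>v\<^sub>0, ..., v\<^sub>m\<close>.
  As every face of a polytope is exposed, all proper faces are \<open>W\<close>-images of the standard simplices
  on initial segments (\<open>proper_face_is_simplex\<close>). All reflections but the last act on \<open>v\<^sub>0, ..., v\<^sub>n\<^sub>-\<^sub>1\<close> as
  adjacent transpositions and hence permute the flags of the standard facet transitively, which gives
  transitivity on flags (\<open>flag_in_orbit\<close>). All proper faces are simplices, so the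
  Schlaefli symbol is \<open>[3, ..., 3, p]\<close> with \<open>p\<close> the number of \<open>(n - 2)\<close>-faces at a face of dimension
  \<open>n - 3\<close> (\<open>schlaefli_symbol\<close>). The same chamber argument shows that \<open>V\<close> is a single orbit of \<open>W\<close>,
  hence the root system when it contains the simple roots (\<open>V_eq_root_orbit\<close>).

  For the unit icosians the hypotheses on \<open>V\<close> are inequalities between 120 explicit vectors, and
  \<open>p = 5\<close> is the number of vertices at inner product \<open>\<phi> / 2\<close> with both ends of an edge.
\<close>

section \<open>Reflections, faces and simplices\<close>

lemma reflection_unit:
  assumes "\<alpha> \<bullet> \<alpha> = 1"
  shows "reflection \<alpha> x = x - (2 * (x \<bullet> \<alpha>)) *\<^sub>R \<alpha>"
  using assms by (simp add: reflection_def)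

lemma reflection_reflection:
  assumes "\<alpha> \<bullet> \<alpha> = 1"
  shows "reflection \<alpha> (reflection \<alpha> x) = x"
  using assms by (simp add: reflection_unit inner_diff_left algebra_simps flip: scaleR_add_left)

lemma orthogonal_transformation_reflection:
  assumes "\<alpha> \<bullet> \<alpha> = 1"
  shows "orthogonal_transformation (reflection \<alpha>)"
proof -
  have "linear (reflection \<alpha>)"
    by (rule linearI) (simp_all add: reflection_unit assms inner_add_left algebra_simps)
  moreover have "reflection \<alpha> x \<bullet> reflection \<alpha> y = x \<bullet> y" for x y
    using assms by (simp add: reflection_unit inner_diff_left inner_diff_right inner_commute algebra_simps)
  ultimately show ?thesis by (simp add: orthogonal_transformation_def)
qed

lemma unit_vectors_eqI:
  fixes x y :: "'a::real_inner"
  assumes "x \<bullet> x = 1" "y \<bullet> y = 1" "1 \<le> x \<bullet> y"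
  shows "x = y"
proof -
  have "(x - y) \<bullet> (x - y) \<le> 0"
    using assms by (simp add: inner_diff_left inner_diff_right inner_commute)
  then have "(x - y) \<bullet> (x - y) = 0" by (intro antisym inner_ge_zero)
  then show ?thesis by simp
qed

text \<open>The sphere is strictly convex: \<open>y \<mapsto> \<langle>x, y\<rangle>\<close> stays below 1 on the other unit
  vectors. Consequently a set of unit vectors can be recovered from its convex hull, and faces can be
  handled through their vertex sets.\<close>

lemma in_convex_hull_of_unit_vectors:
  fixes x :: "'a::real_inner"
  assumes "x \<bullet> x = 1" "\<And>y. y \<in> T \<Longrightarrow> y \<bullet> y = 1" "x \<in> convex hull T"
  shows "x \<in> T"
proof (rule ccontr)
  assume "x \<notin> T"
  then have "T \<subseteq> {y. x \<bullet> y < 1}"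
    using assms unit_vectors_eqI[of x] by (force simp: not_le[symmetric])
  then have "convex hull T \<subseteq> {y. x \<bullet> y < 1}"
    by (simp add: hull_minimal convex_halfspace_lt)
  then show False using assms by auto
qed

text \<open>A face of the hull of \<open>V\<close> is itself the hull of a part of \<open>V\<close>, and for an
  exposed face that part can only consist of the points where the functional is largest.\<close>

lemma convex_hull_supporting_hyperplane:
  fixes V :: "'a::euclidean_space set"
  assumes "finite V" "\<And>x. x \<in> V \<Longrightarrow> u \<bullet> x \<le> b"
  shows "convex hull V \<inter> {x. u \<bullet> x = b} = convex hull {x \<in> V. u \<bullet> x = b}"
    and "convex hull {x \<in> V. u \<bullet> x = b} face_of convex hull V"
proof -
  have "convex hull V \<subseteq> {x. u \<bullet> x \<le> b}"
    using assms by (intro hull_minimal convex_halfspace_le) auto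
  then have face: "convex hull V \<inter> {x. u \<bullet> x = b} face_of convex hull V"
    by (intro face_of_Int_supporting_hyperplane_le) auto
  then obtain T where T: "T \<subseteq> V" "convex hull V \<inter> {x. u \<bullet> x = b} = convex hull T"
    using assms(1) by (meson face_of_convex_hull_subset finite_imp_compact)
  then have "T \<subseteq> {x \<in> V. u \<bullet> x = b}"
    using hull_subset[of T convex] by blast
  then have "convex hull T \<subseteq> convex hull {x \<in> V. u \<bullet> x = b}"
    by (rule hull_mono)
  moreover have "convex hull {x \<in> V. u \<bullet> x = b} \<subseteq> convex hull V \<inter> {x. u \<bullet> x = b}"
    by (intro hull_minimal convex_Int convex_convex_hull convex_hyperplane) (auto simp: hull_inc)
  ultimately show *: "convex hull V \<inter> {x. u \<bullet> x = b} = convex hull {x \<in> V. u \<bullet> x = b}"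
    using T by blast
  show "convex hull {x \<in> V. u \<bullet> x = b} face_of convex hull V"
    using face by (simp only: *)
qed

lemma convex_hull_subset_iff_affine_independent:
  fixes S :: "'a::euclidean_space set"
  assumes "\<not> affine_dependent S" "C \<subseteq> S" "D \<subseteq> S"
  shows "convex hull C \<subseteq> convex hull D \<longleftrightarrow> C \<subseteq> D"
proof
  assume CD: "convex hull C \<subseteq> convex hull D"
  have D: "convex hull D face_of convex hull S"
    using assms by (auto simp: face_of_convex_hull_affine_independent)
  show "C \<subseteq> D"
  proof
    fix x assume "x \<in> C"
    then have "x \<in> convex hull D" "x extreme_point_of convex hull S"
      using CD assms by (auto simp: hull_inc extreme_point_of_convex_hull_affine_independent)
    then show "x \<in> D"
      using D extreme_point_of_face extreme_point_of_convex_hull by blast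
  qed
qed (rule hull_mono)

text \<open>The faces of a simplex correspond to the subsets of its vertex set; those one
  dimension above \<open>C\<close> add a single vertex.\<close>

lemma card_simplex_faces_above:
  fixes S :: "'a::euclidean_space set"
  assumes S: "\<not> affine_dependent S" and CS: "C \<subseteq> S"
  shows "card {H. H face_of convex hull S \<and> convex hull C \<subseteq> H \<and> aff_dim H = int (card C)}
    = card S - card C"
proof -
  have fin: "finite S" using S aff_independent_finite by blast
  then have finC: "finite C" using CS finite_subset by blast
  have dim: "aff_dim (convex hull D) = int (card D) - 1" if "D \<subseteq> S" for D
    using affine_independent_subset[OF S that] by (simp add: aff_dim_convex_hull affine_independent_iff_card)
  have "{H. H face_of convex hull S \<and> convex hull C \<subseteq> H \<and> aff_dim H = int (card C)}
    = (\<lambda>x. convex hull insert x C) ` (S - C)" (is "?L = ?R")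
  proof
    show "?L \<subseteq> ?R"
    proof
      fix H assume H: "H \<in> ?L"
      then obtain D where D: "D \<subseteq> S" "H = convex hull D"
        using S by (auto simp: face_of_convex_hull_affine_independent)
      then have "C \<subseteq> D" "card D = Suc (card C)"
        using H convex_hull_subset_iff_affine_independent[OF S CS] dim[of D] by auto
      then have "card (D - C) = 1" using finC by (simp add: card_Diff_subset)
      then obtain x where "D - C = {x}" by (rule card_1_singletonE)
      then have "D = insert x C" "x \<notin> C" using \<open>C \<subseteq> D\<close> by blast+
      then show "H \<in> ?R" using D by blast
    qed
    show "?R \<subseteq> ?L"
    proof
      fix H assume "H \<in> ?R"
      then obtain x where x: "x \<in> S - C" "H = convex hull insert x C" by blast
      then have "aff_dim H = int (card C)"
        using dim[of "insert x C"] CS finC by simp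
      moreover have "convex hull C \<subseteq> H" unfolding x by (rule hull_mono) blast
      moreover have "H face_of convex hull S"
        unfolding face_of_convex_hull_affine_independent[OF S] using x CS by blast
      ultimately show "H \<in> ?L" by blast
    qed
  qed
  moreover have "inj_on (\<lambda>x. convex hull insert x C) (S - C)"
  proof (rule inj_onI)
    fix x y assume xy: "x \<in> S - C" "y \<in> S - C" "convex hull insert x C = convex hull insert y C"
    then have "insert x C \<subseteq> insert y C"
      using convex_hull_subset_iff_affine_independent[OF S, of "insert x C" "insert y C"] CS by auto
    then show "x = y" using xy by auto
  qed
  ultimately show ?thesis
    using fin CS by (simp add: card_image card_Diff_subset finC)
qed

section \<open>The group generated by simple reflections\<close>

inductive_set reflection_group :: "(nat \<Rightarrow> 'a::euclidean_space) \<Rightarrow> nat \<Rightarrow> ('a \<Rightarrow> 'a) set"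
  for a :: "nat \<Rightarrow> 'a" and n :: nat where
    one: "id \<in> reflection_group a n"
  | mult: "g \<in> reflection_group a n \<Longrightarrow> i < n \<Longrightarrow> reflection (a i) \<circ> g \<in> reflection_group a n"

lemma reflection_group_comp:
  assumes "g \<in> reflection_group a n" "h \<in> reflection_group a n"
  shows "g \<circ> h \<in> reflection_group a n"
  using assms by induction (auto intro: reflection_group.mult simp: comp_assoc)

lemma reflection_group_generator:
  assumes "i < n"
  shows "reflection (a i) \<in> reflection_group a n"
  using reflection_group.mult[OF reflection_group.one assms] by simp

locale unit_roots =
  fixes a :: "nat \<Rightarrow> 'a::euclidean_space" and n :: nat
  assumes root_unit: "i < n \<Longrightarrow> a i \<bullet> a i = 1"
begin

abbreviation "W \<equiv> reflection_group a n"

lemma W_orthogonal: "g \<in> W \<Longrightarrow> orthogonal_transformation g"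
proof (induction rule: reflection_group.induct)
  case one
  then show ?case by (simp add: id_def)
next
  case (mult g i)
  then show ?case
    by (intro orthogonal_transformation_compose orthogonal_transformation_reflection root_unit)
qed

lemma W_linear: "g \<in> W \<Longrightarrow> linear g"
  using W_orthogonal orthogonal_transformation_linear by blast

lemma W_inj: "g \<in> W \<Longrightarrow> inj g"
  using W_orthogonal orthogonal_transformation_inj by blast

lemma W_inner: "g \<in> W \<Longrightarrow> g x \<bullet> g y = x \<bullet> y"
  using W_orthogonal by (simp add: orthogonal_transformation_def)

lemma W_inverse: "g \<in> W \<Longrightarrow> \<exists>h\<in>W. \<forall>x. h (g x) = x \<and> g (h x) = x"
proof (induction rule: reflection_group.induct)
  case one
  show ?case by (rule bexI[of _ id]) (simp_all add: reflection_group.one)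
next
  case (mult g i)
  then obtain h where h: "h \<in> W" "\<forall>x. h (g x) = x \<and> g (h x) = x" by blast
  then have "h \<circ> reflection (a i) \<in> W"
    using mult by (intro reflection_group_comp reflection_group_generator)
  then show ?case
    using h mult by (intro bexI[of _ "h \<circ> reflection (a i)"]) (auto simp: reflection_reflection root_unit)
qed

lemma W_convex_hull: "g \<in> W \<Longrightarrow> g ` (convex hull T) = convex hull (g ` T)"
  by (simp add: convex_hull_linear_image W_linear)

end

section \<open>Polytopes whose faces are images of initial segments\<close>

text \<open>The weight condition says that the sum of the initial segment \<open>v 0, ..., v k\<close> exposes precisely
  this segment among the points of \<open>V\<close>. The conditions on \<open>v\<close> before it make the reflection in \<open>a i\<close>
  the transposition of \<open>v i\<close> and \<open>v (Suc i)\<close> on the chain; the last reflection has no second point to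
  move to and leads out of the chain.\<close>

locale reflection_polytope = unit_roots a n
  for a :: "nat \<Rightarrow> 'a::euclidean_space" and n :: nat +
  fixes V :: "'a set" and v :: "nat \<Rightarrow> 'a"
  assumes n_eq: "n = DIM('a)"
    and roots_total: "(\<And>i. i < n \<Longrightarrow> u \<bullet> a i = 0) \<Longrightarrow> u = 0"
    and finite_V: "finite V"
    and V_unit: "x \<in> V \<Longrightarrow> x \<bullet> x = 1"
    and V_reflection: "x \<in> V \<Longrightarrow> i < n \<Longrightarrow> reflection (a i) x \<in> V"
    and v_in_V: "k < n \<Longrightarrow> v k \<in> V"
    and v_pos: "k < n \<Longrightarrow> 0 < v k \<bullet> a k"
    and v_step: "Suc k < n \<Longrightarrow> reflection (a k) (v k) = v (Suc k)"
    and v_orth: "k < n \<Longrightarrow> i < n \<Longrightarrow> k \<noteq> i \<Longrightarrow> k \<noteq> Suc i \<Longrightarrow> v k \<bullet> a i = 0"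
    and weight_max: "k < n \<Longrightarrow> x \<in> V \<Longrightarrow> x \<notin> v ` {..k} \<Longrightarrow>
      x \<bullet> (\<Sum>j\<le>k. v j) < v 0 \<bullet> (\<Sum>j\<le>k. v j)"
begin

abbreviation (input) "P \<equiv> convex hull V"

text \<open>Up to scaling, the basis dual to the simple roots, as \<open>weight_root\<close> shows: the reflection
  in \<open>a i\<close> permutes the summands unless \<open>i = k\<close>.\<close>

definition weight :: "nat \<Rightarrow> 'a" where "weight k = (\<Sum>j\<le>k. v j)"

lemma n_pos: "0 < n" by (simp add: n_eq)

lemma v_Suc: "Suc k < n \<Longrightarrow> v (Suc k) = v k - (2 * (v k \<bullet> a k)) *\<^sub>R a k"
  using v_step[of k] root_unit[of k] by (simp add: reflection_unit)

lemma weight_root: "k < n \<Longrightarrow> i < n \<Longrightarrow> weight k \<bullet> a i = (if i = k then v k \<bullet> a k else 0)"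
proof (induction k)
  case 0
  then show ?case using v_orth[of 0 i] by (auto simp: weight_def)
next
  case (Suc k)
  have "weight (Suc k) \<bullet> a i = weight k \<bullet> a i + v (Suc k) \<bullet> a i"
    by (simp add: weight_def inner_add_left)
  moreover have "v (Suc k) \<bullet> a k = - (v k \<bullet> a k)"
    using Suc root_unit[of k] by (simp add: v_Suc inner_diff_left)
  ultimately show ?case
    using Suc v_orth[of "Suc k" i] by (auto split: if_splits)
qed

lemma root_weight: "k < n \<Longrightarrow> i < n \<Longrightarrow> a i \<bullet> weight k = (if i = k then v k \<bullet> a k else 0)"
  using weight_root by (simp add: inner_commute)

lemma weight_v_eq: "k < n \<Longrightarrow> j \<le> k \<Longrightarrow> v j \<bullet> weight k = v 0 \<bullet> weight k"
proof (induction j)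
  case (Suc j)
  then show ?case using root_weight[of k j] by (simp add: v_Suc inner_diff_left)
qed simp

lemma weight_v_less: "k < n \<Longrightarrow> j < k \<Longrightarrow> v k \<bullet> weight j < v 0 \<bullet> weight j"
proof (induction k)
  case (Suc k)
  show ?case
  proof (cases "j = k")
    case True
    have "v (Suc k) \<bullet> weight k = v k \<bullet> weight k - 2 * (v k \<bullet> a k)\<^sup>2"
      using Suc root_weight[of k k] by (simp add: v_Suc inner_diff_left power2_eq_square)
    then show ?thesis using True Suc v_pos[of k] weight_v_eq[of k k] by simp
  next
    case False
    then show ?thesis using Suc root_weight[of j k] by (simp add: v_Suc inner_diff_left)
  qed
qed simp

lemma v_distinct: "j < k \<Longrightarrow> k < n \<Longrightarrow> v j \<noteq> v k"
  using weight_v_less[of k j] weight_v_eq[of j j] by force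

lemma inj_on_v: "inj_on v {..<n}"
proof (rule inj_onI)
  fix j k assume "j \<in> {..<n}" "k \<in> {..<n}" "v j = v k"
  then show "j = k"
    using v_distinct[of j k] v_distinct[of k j] by (cases j k rule: linorder_cases) simp_all
qed

lemma weight_V_less: "k < n \<Longrightarrow> x \<in> V \<Longrightarrow> x \<notin> v ` {..k} \<Longrightarrow> x \<bullet> weight k < v 0 \<bullet> weight k"
  unfolding weight_def by (rule weight_max)

lemma weight_V_eq_iff:
  assumes "k < n" "x \<in> V"
  shows "x \<bullet> weight k = v 0 \<bullet> weight k \<longleftrightarrow> x \<in> v ` {..k}"
proof
  assume "x \<bullet> weight k = v 0 \<bullet> weight k"
  then show "x \<in> v ` {..k}" using weight_V_less[OF assms] by linarith
next
  assume "x \<in> v ` {..k}"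
  then obtain j where "j \<le> k" "x = v j" by blast
  then show "x \<bullet> weight k = v 0 \<bullet> weight k" using weight_v_eq[OF assms(1), of j] by simp
qed

lemma weight_V_le:
  assumes "k < n" "x \<in> V"
  shows "x \<bullet> weight k \<le> v 0 \<bullet> weight k"
  using weight_V_eq_iff[OF assms] weight_V_less[OF assms] by linarith

lemma W_in_V: "g \<in> W \<Longrightarrow> x \<in> V \<Longrightarrow> g x \<in> V"
  by (induction arbitrary: x rule: reflection_group.induct) (auto intro: V_reflection)

lemma W_image_V: "g \<in> W \<Longrightarrow> g ` V = V"
  using W_inverse[of g] W_in_V by (metis image_eqI image_subsetI subsetI subset_antisym)

lemma W_image_P: "g \<in> W \<Longrightarrow> g ` P = P"
  by (simp add: W_convex_hull W_image_V)

lemma W_face_iff: "g \<in> W \<Longrightarrow> g ` F face_of P \<longleftrightarrow> F face_of P"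
  using face_of_linear_image[of g F P] by (simp add: W_linear W_inj W_image_P)

lemma W_aff_dim: "g \<in> W \<Longrightarrow> aff_dim (g ` F) = aff_dim F"
  by (simp add: W_linear W_inj)

text \<open>The orbit of the sum of all weights is finite, because it is determined by where the
  chain \<open>v\<close> goes inside the finite set \<open>V\<close>. Among its points take \<open>g rho\<close> with the largest inner product
  with \<open>u\<close>: a root \<open>g (a i)\<close> on the wrong side of \<open>u\<close> would allow a further increase.\<close>

lemma exists_chamber: "\<exists>g\<in>W. \<forall>i<n. 0 \<le> u \<bullet> g (a i)"
proof -
  define rho where "rho = (\<Sum>k<n. weight k)"
  have rho: "0 < rho \<bullet> a i" if "i < n" for i
  proof -
    have "rho \<bullet> a i = (\<Sum>k<n. if i = k then v k \<bullet> a k else 0)"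
      using that by (simp add: rho_def inner_sum_left weight_root)
    then show ?thesis using that v_pos by simp
  qed
  have "finite ((\<lambda>g. g rho) ` W)"
  proof (rule finite_subset)
    show "(\<lambda>g. g rho) ` W \<subseteq> (\<lambda>f. \<Sum>k<n. \<Sum>j\<le>k. f j) ` ({..<n} \<rightarrow>\<^sub>E V)"
    proof (rule image_subsetI)
      fix g assume g: "g \<in> W"
      have "g rho = (\<Sum>k<n. \<Sum>j\<le>k. g (v j))"
        using W_linear[OF g] by (simp add: rho_def weight_def linear_sum)
      also have "\<dots> = (\<Sum>k<n. \<Sum>j\<le>k. restrict (g \<circ> v) {..<n} j)"
        by (intro sum.cong) auto
      finally have "g rho = (\<Sum>k<n. \<Sum>j\<le>k. restrict (g \<circ> v) {..<n} j)" .
      moreover have "restrict (g \<circ> v) {..<n} \<in> {..<n} \<rightarrow>\<^sub>E V"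
        using g W_in_V v_in_V by auto
      ultimately show "g rho \<in> (\<lambda>f. \<Sum>k<n. \<Sum>j\<le>k. f j) ` ({..<n} \<rightarrow>\<^sub>E V)"
        by (rule image_eqI)
    qed
    show "finite ((\<lambda>f. \<Sum>k<n. \<Sum>j\<le>k. f j) ` ({..<n} \<rightarrow>\<^sub>E V))"
      using finite_V by (intro finite_imageI finite_PiE) auto
  qed
  from finite_imageI[OF this, of "\<lambda>y. u \<bullet> y"]
  have fin: "finite ((\<lambda>g. u \<bullet> g rho) ` W)" (is "finite ?S")
    by (simp only: image_image)
  have "?S \<noteq> {}" using reflection_group.one by blast
  then have "Max ?S \<in> ?S" using fin by (rule Max_in[rotated])
  then obtain g where g: "g \<in> W" "u \<bullet> g rho = Max ?S" by auto
  have max: "u \<bullet> h rho \<le> u \<bullet> g rho" if "h \<in> W" for h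
    unfolding g(2) using fin that by (intro Max_ge) auto
  have "0 \<le> u \<bullet> g (a i)" if i: "i < n" for i
  proof -
    have "g (reflection (a i) rho) = g rho - (2 * (rho \<bullet> a i)) *\<^sub>R g (a i)"
      using W_linear[OF g(1)] by (simp add: reflection_unit root_unit i linear_diff linear_scale)
    moreover have "u \<bullet> (g \<circ> reflection (a i)) rho \<le> u \<bullet> g rho"
      using g i by (intro max reflection_group_comp reflection_group_generator)
    ultimately have "0 \<le> (rho \<bullet> a i) * (u \<bullet> g (a i))" by (simp add: inner_diff_right)
    then show ?thesis using rho[OF i] by (simp add: zero_le_mult_iff)
  qed
  with g show ?thesis by blast
qed

text \<open>Both sides have the same inner products with all simple roots.\<close>

lemma weight_expansion: "u = (\<Sum>k<n. ((u \<bullet> a k) / (v k \<bullet> a k)) *\<^sub>R weight k)" (is "_ = ?s")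
proof -
  have "u - ?s = 0"
  proof (rule roots_total)
    fix i assume i: "i < n"
    have "?s \<bullet> a i = (\<Sum>k<n. if k = i then u \<bullet> a k else 0)"
      unfolding inner_sum_left
    proof (rule sum.cong)
      fix k assume "k \<in> {..<n}"
      then show "((u \<bullet> a k) / (v k \<bullet> a k)) *\<^sub>R weight k \<bullet> a i = (if k = i then u \<bullet> a k else 0)"
        using i v_pos[of k] by (auto simp: weight_root)
    qed simp
    then show "(u - ?s) \<bullet> a i = 0" using i by (simp add: inner_diff_left)
  qed
  then show ?thesis by simp
qed

text \<open>Let \<open>m\<close> be the first index at which \<open>u\<close> has a positive coefficient in terms of the
  weights. The loss \<open>\<langle>u, v 0\<rangle> - \<langle>u, x\<rangle>\<close> is a nonnegative combination of the losses
  for the single weights, so it vanishes iff \<open>x\<close> is maximal for all weights that occur. Their maximal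
  sets are nested, and the smallest one belongs to \<open>m\<close>.\<close>

lemma dominant_argmax:
  assumes dom: "\<And>i. i < n \<Longrightarrow> 0 \<le> u \<bullet> a i" and "u \<noteq> 0"
  shows "\<exists>m<n. \<forall>x\<in>V. u \<bullet> x \<le> u \<bullet> v 0 \<and> (u \<bullet> x = u \<bullet> v 0 \<longleftrightarrow> x \<in> v ` {..m})"
proof -
  define c where "c k = (u \<bullet> a k) / (v k \<bullet> a k)" for k
  have c: "0 \<le> c k" if "k < n" for k
    using that dom v_pos[of k] by (simp add: c_def)
  have "\<exists>k<n. c k \<noteq> 0"
  proof (rule ccontr)
    assume "\<not> ?thesis"
    then have "(\<Sum>k<n. c k *\<^sub>R weight k) = 0" by simp
    then show False using weight_expansion[of u] \<open>u \<noteq> 0\<close> by (simp only: c_def)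
  qed
  define m where "m = (LEAST k. k < n \<and> c k \<noteq> 0)"
  have m: "m < n" "c m \<noteq> 0"
    using LeastI_ex[OF \<open>\<exists>k<n. c k \<noteq> 0\<close>] unfolding m_def by auto
  have m_least: "m \<le> k" if "k < n" "c k \<noteq> 0" for k
    unfolding m_def using that by (intro Least_le) auto
  have expand: "u \<bullet> y = (\<Sum>k<n. c k * (y \<bullet> weight k))" for y
    using arg_cong[OF weight_expansion[of u], of "\<lambda>z. y \<bullet> z"]
    by (simp only: c_def inner_sum_right inner_scaleR_right inner_commute[of u])
  have diff: "u \<bullet> v 0 - u \<bullet> x = (\<Sum>k<n. c k * (v 0 \<bullet> weight k - x \<bullet> weight k))" for x
    by (simp only: expand right_diff_distrib sum_subtractf)
  have nonneg: "0 \<le> c k * (v 0 \<bullet> weight k - x \<bullet> weight k)" if "k < n" "x \<in> V" for k x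
    using that c weight_V_le by simp
  have "u \<bullet> x \<le> u \<bullet> v 0 \<and> (u \<bullet> x = u \<bullet> v 0 \<longleftrightarrow> x \<in> v ` {..m})" if x: "x \<in> V" for x
  proof
    show "u \<bullet> x \<le> u \<bullet> v 0"
    proof -
      have "0 \<le> u \<bullet> v 0 - u \<bullet> x"
        unfolding diff using x by (intro sum_nonneg nonneg) auto
      then show ?thesis by simp
    qed
    have iff: "c k * (v 0 \<bullet> weight k - x \<bullet> weight k) = 0 \<longleftrightarrow> (c k \<noteq> 0 \<longrightarrow> x \<in> v ` {..k})"
      if "k < n" for k
      using weight_V_eq_iff[OF that x] by auto
    have "u \<bullet> x = u \<bullet> v 0 \<longleftrightarrow> u \<bullet> v 0 - u \<bullet> x = 0" by auto
    also have "\<dots> \<longleftrightarrow> (\<forall>k\<in>{..<n}. c k * (v 0 \<bullet> weight k - x \<bullet> weight k) = 0)"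
      unfolding diff using x by (intro sum_nonneg_eq_0_iff nonneg) auto
    also have "\<dots> \<longleftrightarrow> (\<forall>k<n. c k \<noteq> 0 \<longrightarrow> x \<in> v ` {..k})"
      using iff by blast
    also have "\<dots> \<longleftrightarrow> x \<in> v ` {..m}"
    proof
      assume "x \<in> v ` {..m}"
      then obtain j where j: "j \<le> m" "x = v j" by auto
      show "\<forall>k<n. c k \<noteq> 0 \<longrightarrow> x \<in> v ` {..k}"
      proof (intro allI impI)
        fix k assume "k < n" "c k \<noteq> 0"
        then show "x \<in> v ` {..k}" using j m_least[of k] by simp
      qed
    next
      assume "\<forall>k<n. c k \<noteq> 0 \<longrightarrow> x \<in> v ` {..k}"
      then show "x \<in> v ` {..m}" using m by simp
    qed
    finally show "u \<bullet> x = u \<bullet> v 0 \<longleftrightarrow> x \<in> v ` {..m}" .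
  qed
  then show ?thesis using m(1) by (intro exI[of _ m] conjI ballI) simp_all
qed

text \<open>Move \<open>x\<close> into the chamber. There \<open>v 0\<close> is at least as close to \<open>x\<close> as \<open>x\<close> itself, and both
  have length one.\<close>

lemma V_single_orbit: assumes "x \<in> V" shows "\<exists>g\<in>W. x = g (v 0)"
proof -
  from exists_chamber[of x] obtain g where g: "g \<in> W" "\<forall>i<n. 0 \<le> x \<bullet> g (a i)" ..
  from W_inverse[OF g(1)] obtain h where h: "h \<in> W" "\<forall>y. h (g y) = y \<and> g (h y) = y" ..
  have "0 \<le> h x \<bullet> a i" if "i < n" for i
  proof -
    have "h x \<bullet> a i = g (h x) \<bullet> g (a i)" by (simp only: W_inner[OF g(1)])
    then show ?thesis using g(2) h(2) that by simp
  qed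
  moreover have hx: "h x \<in> V" using W_in_V[OF h(1) assms] .
  moreover have "h x \<noteq> 0"
  proof
    assume "h x = 0"
    then show False using V_unit[OF hx] by simp
  qed
  ultimately have "h x \<bullet> h x \<le> h x \<bullet> v 0"
    using dominant_argmax[of "h x"] hx by metis
  then have "1 \<le> h x \<bullet> v 0" by (simp only: V_unit[OF hx])
  then have "h x = v 0"
    by (rule unit_vectors_eqI[OF V_unit[OF hx] V_unit[OF v_in_V[OF n_pos]]])
  then have "x = g (v 0)" using h(2) by metis
  then show ?thesis using g(1) by (rule bexI)
qed

lemma V_eq_root_orbit:
  assumes "\<And>i. i < n \<Longrightarrow> a i \<in> V"
  shows "V = root_orbit a n"
proof
  have W: "g x \<in> root_orbit a n" if "g \<in> W" "x \<in> root_orbit a n" for g x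
    using that by induction (simp_all add: root_orbit.reflect)
  from V_single_orbit[OF assms[OF n_pos]] obtain g where g: "g \<in> W" "a 0 = g (v 0)" ..
  from W_inverse[OF g(1)] obtain h where h: "h \<in> W" "\<forall>x. h (g x) = x \<and> g (h x) = x" ..
  have "h (a 0) \<in> root_orbit a n" using W[OF h(1)] root_orbit.simple[OF n_pos] .
  then have "v 0 \<in> root_orbit a n" by (simp add: g h)
  then have "g (v 0) \<in> root_orbit a n" if "g \<in> W" for g using W[OF that] by simp
  then show "V \<subseteq> root_orbit a n" using V_single_orbit by (metis subsetI)
  show "root_orbit a n \<subseteq> V"
  proof
    fix x assume "x \<in> root_orbit a n"
    then show "x \<in> V" by induction (auto intro: assms V_reflection)
  qed
qed

section \<open>The faces and their dimensions\<close>

text \<open>Indexed by the number of vertices, so that the empty face is included as \<open>k = 0\<close> and the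
  dimension is \<open>k - 1\<close>.\<close>

definition simplex_vertices :: "nat \<Rightarrow> 'a set" where "simplex_vertices k = v ` {..<k}"

lemma simplex_vertices_subset: "k \<le> n \<Longrightarrow> simplex_vertices k \<subseteq> V"
  by (auto simp: simplex_vertices_def intro: v_in_V)

lemma card_simplex_vertices: "k \<le> n \<Longrightarrow> card (simplex_vertices k) = k"
  unfolding simplex_vertices_def
  by (subst card_image) (auto intro: inj_on_subset[OF inj_on_v])

lemma simplex_vertices_Suc: "simplex_vertices (Suc k) = insert (v k) (simplex_vertices k)"
  by (simp add: simplex_vertices_def lessThan_Suc)

lemma v_notin_simplex_vertices: "k < n \<Longrightarrow> v k \<notin> simplex_vertices k"
  using v_distinct by (fastforce simp: simplex_vertices_def)

text \<open>The weight \<open>k\<close> is constant on the first \<open>k + 1\<close> points of the chain and smaller at all later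
  ones; this makes the chain affinely independent.\<close>

lemma affine_hull_simplex_vertices:
  "k < n \<Longrightarrow> affine hull (simplex_vertices (Suc k)) \<subseteq> {x. weight k \<bullet> x = weight k \<bullet> v 0}"
proof (rule hull_minimal)
  assume k: "k < n"
  show "simplex_vertices (Suc k) \<subseteq> {x. weight k \<bullet> x = weight k \<bullet> v 0}"
  proof
    fix x assume "x \<in> simplex_vertices (Suc k)"
    then obtain j where "j \<le> k" "x = v j" by (auto simp: simplex_vertices_def less_Suc_eq_le)
    then show "x \<in> {x. weight k \<bullet> x = weight k \<bullet> v 0}"
      using weight_v_eq[OF k, of j] by (simp add: inner_commute)
  qed
qed (rule affine_hyperplane)

lemma aff_dim_simplex_vertices: "k \<le> n \<Longrightarrow> aff_dim (simplex_vertices k) = int k - 1"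
proof (induction k)
  case 0
  then show ?case by (simp add: simplex_vertices_def)
next
  case (Suc k)
  have "v k \<notin> affine hull simplex_vertices k"
  proof (cases k)
    case 0
    then show ?thesis by (simp add: simplex_vertices_def)
  next
    case (Suc j)
    then show ?thesis
      using affine_hull_simplex_vertices[of j] weight_v_less[of k j] \<open>Suc k \<le> n\<close>
      by (auto simp: inner_commute)
  qed
  then show ?case using Suc by (simp add: simplex_vertices_Suc aff_dim_insert)
qed

text \<open>The last reflection moves \<open>v (n - 1)\<close> off the facet spanned by the chain.\<close>

lemma aff_dim_P: "aff_dim P = int n"
proof -
  let ?m = "n - 1" and ?S = "simplex_vertices n"
  let ?x = "reflection (a ?m) (v ?m)"
  have m: "?m < n" "Suc ?m = n" using n_pos by simp_all
  have "weight ?m \<bullet> ?x = weight ?m \<bullet> v 0 - 2 * (v ?m \<bullet> a ?m)\<^sup>2"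
    using weight_root[OF m(1) m(1)] weight_v_eq[OF m(1), of ?m] root_unit[OF m(1)]
    by (simp add: reflection_unit inner_diff_right power2_eq_square)
      (simp add: inner_commute)
  then have "?x \<notin> affine hull ?S"
    using affine_hull_simplex_vertices[OF m(1)] v_pos[OF m(1)] unfolding m by auto
  then have "aff_dim (insert ?x ?S) = int n"
    by (simp add: aff_dim_insert aff_dim_simplex_vertices)
  moreover have "insert ?x ?S \<subseteq> V"
    using simplex_vertices_subset[of n] V_reflection[OF v_in_V[OF m(1)] m(1)] by simp
  ultimately have "int n \<le> aff_dim V" using aff_dim_subset by metis
  moreover have "aff_dim V \<le> int n" using aff_dim_le_DIM[of V] by (simp add: n_eq)
  ultimately show ?thesis by (simp add: aff_dim_convex_hull)
qed

lemma convex_hull_subset_V_iff: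
  assumes "S \<subseteq> V" "T \<subseteq> V"
  shows "convex hull S \<subseteq> convex hull T \<longleftrightarrow> S \<subseteq> T"
proof
  assume *: "convex hull S \<subseteq> convex hull T"
  show "S \<subseteq> T"
  proof
    fix x assume "x \<in> S"
    then have "x \<in> convex hull T" using * by (auto simp: hull_inc)
    then show "x \<in> T"
      using in_convex_hull_of_unit_vectors[of x T] \<open>x \<in> S\<close> assms V_unit by blast
  qed
qed (rule hull_mono)

lemma convex_hull_eq_V_iff:
  "S \<subseteq> V \<Longrightarrow> T \<subseteq> V \<Longrightarrow> convex hull S = convex hull T \<longleftrightarrow> S = T"
  using convex_hull_subset_V_iff[of S T] convex_hull_subset_V_iff[of T S] by blast

lemma vertices_P: "polytope_vertices P = V"
proof -
  have "x \<notin> convex hull (V - {x})" if "x \<in> V" for x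
    using in_convex_hull_of_unit_vectors[of x "V - {x}"] that V_unit by blast
  then show ?thesis
    using extreme_point_of_convex_hull_convex_independent[OF finite_imp_compact[OF finite_V]]
    by (auto simp: polytope_vertices_def)
qed

lemma W_image_subset_V: "g \<in> W \<Longrightarrow> S \<subseteq> V \<Longrightarrow> g ` S \<subseteq> V"
  using W_in_V by blast

lemma simplex_face: "g \<in> W \<Longrightarrow> k \<le> n \<Longrightarrow> convex hull (g ` simplex_vertices k) face_of P"
proof -
  assume g: "g \<in> W" and "k \<le> n"
  have "convex hull (simplex_vertices k) face_of P"
  proof (cases k)
    case 0
    then show ?thesis by (simp add: simplex_vertices_def)
  next
    case (Suc j)
    then have j: "j < n" using \<open>k \<le> n\<close> by simp
    have "simplex_vertices k = {x \<in> V. weight j \<bullet> x = weight j \<bullet> v 0}"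
    proof -
      have "x \<in> simplex_vertices k \<longleftrightarrow> x \<in> V \<and> x \<bullet> weight j = v 0 \<bullet> weight j" for x
        using weight_V_eq_iff[OF j, of x] simplex_vertices_subset[OF \<open>k \<le> n\<close>] Suc
        by (auto simp: simplex_vertices_def lessThan_Suc_atMost)
      then show ?thesis by (auto simp: inner_commute)
    qed
    then show ?thesis
      using convex_hull_supporting_hyperplane(2)[OF finite_V, of "weight j" "weight j \<bullet> v 0"]
        weight_V_le[OF j] by (simp add: inner_commute)
  qed
  then show ?thesis using W_face_iff[OF g] by (simp flip: W_convex_hull[OF g])
qed

lemma aff_dim_simplex:
  "g \<in> W \<Longrightarrow> k \<le> n \<Longrightarrow> aff_dim (convex hull (g ` simplex_vertices k)) = int k - 1"
  by (simp add: aff_dim_convex_hull W_aff_dim aff_dim_simplex_vertices)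

text \<open>Every face of a polytope is exposed by some \<open>u\<close>. Transporting \<open>u\<close> into the chamber
  makes its set of maximal points an initial segment of the chain.\<close>

lemma proper_face_is_simplex:
  assumes F: "F face_of P" and "F \<noteq> P"
  shows "\<exists>g\<in>W. \<exists>k\<le>n. F = convex hull (g ` simplex_vertices k)"
proof (cases "F = {}")
  case True
  then have "F = convex hull (id ` simplex_vertices 0)" by (simp add: simplex_vertices_def)
  then show ?thesis using reflection_group.one by blast
next
  case False
  have "F exposed_face_of P"
    using F exposed_face_of_polyhedron polytope_imp_polyhedron polytope_convex_hull finite_V by blast
  then obtain u b where u: "u \<noteq> 0" "P \<subseteq> {x. u \<bullet> x \<le> b}" "F = P \<inter> {x. u \<bullet> x = b}"
    using False \<open>F \<noteq> P\<close> unfolding exposed_face_of by blast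
  have le: "u \<bullet> x \<le> b" if "x \<in> V" for x using u(2) that hull_inc[of x V convex] by blast
  have F_eq: "F = convex hull {x \<in> V. u \<bullet> x = b}"
    using convex_hull_supporting_hyperplane(1)[OF finite_V le] u(3) by simp
  then have "{x \<in> V. u \<bullet> x = b} \<noteq> {}" using False by (metis convex_hull_empty)
  then obtain x0 where x0: "x0 \<in> V" "u \<bullet> x0 = b" by blast
  from exists_chamber[of u] obtain g where g: "g \<in> W" "\<forall>i<n. 0 \<le> u \<bullet> g (a i)" ..
  from W_inverse[OF g(1)] obtain h where h: "h \<in> W" "\<forall>x. h (g x) = x \<and> g (h x) = x" ..
  have hu: "h u \<bullet> x = u \<bullet> g x" for x
    using W_inner[OF g(1), of "h u" x] h(2) by simp
  have "h u \<noteq> 0"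
  proof
    assume "h u = 0"
    then have "g 0 = u" using h(2) by metis
    then show False using u(1) linear_0[OF W_linear[OF g(1)]] by simp
  qed
  then obtain m where m: "m < n"
    "\<forall>x\<in>V. h u \<bullet> x \<le> h u \<bullet> v 0 \<and> (h u \<bullet> x = h u \<bullet> v 0 \<longleftrightarrow> x \<in> v ` {..m})"
    using dominant_argmax[of "h u"] g(2) hu by auto
  have "b = h u \<bullet> v 0"
  proof (rule antisym)
    have "h u \<bullet> h x0 \<le> h u \<bullet> v 0" using m(2) W_in_V[OF h(1) x0(1)] by blast
    then show "b \<le> h u \<bullet> v 0" using h(2) x0(2) by (simp add: hu)
    show "h u \<bullet> v 0 \<le> b" using le W_in_V[OF g(1)] v_in_V[OF n_pos] by (simp add: hu)
  qed
  \<comment> \<open>\<open>h\<close> is the inverse of \<open>g\<close>, so \<open>u\<close> is maximal at \<open>g y\<close> iff \<open>h u\<close> is maximal at \<open>y\<close>.\<close>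
  then have "{x \<in> V. u \<bullet> x = b} = g ` (v ` {..m})"
  proof -
    assume b: "b = h u \<bullet> v 0"
    have gv: "g y \<in> V" if "y \<in> v ` {..m}" for y
      using that m(1) v_in_V W_in_V[OF g(1)] by auto
    have "x \<in> V \<and> u \<bullet> x = b \<longleftrightarrow> x \<in> g ` (v ` {..m})" for x
    proof
      assume x: "x \<in> V \<and> u \<bullet> x = b"
      then have "h u \<bullet> h x = h u \<bullet> v 0" using b h(2) by (simp add: hu)
      then have "h x \<in> v ` {..m}" using m(2) W_in_V[OF h(1)] x by blast
      then show "x \<in> g ` (v ` {..m})" using h(2) by (metis image_eqI)
    next
      assume "x \<in> g ` (v ` {..m})"
      then obtain y where y: "y \<in> v ` {..m}" "x = g y" by blast
      then have "y \<in> V" using m(1) v_in_V by auto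
      then have "h u \<bullet> y = h u \<bullet> v 0" using m(2) y(1) by blast
      then show "x \<in> V \<and> u \<bullet> x = b" using y gv b by (simp add: hu)
    qed
    then show ?thesis by blast
  qed
  then have "F = convex hull (g ` simplex_vertices (Suc m))"
    by (simp add: F_eq simplex_vertices_def lessThan_Suc_atMost)
  then show ?thesis using g(1) m(1) by (intro bexI[of _ g] exI[of _ "Suc m"]) simp_all
qed

lemma face_of_aff_dim:
  assumes "F face_of P" "aff_dim F = int k - 1" "k \<le> n"
  shows "\<exists>g\<in>W. F = convex hull (g ` simplex_vertices k)"
proof -
  have "F \<noteq> P" using assms aff_dim_P by auto
  with assms(1) obtain g j where g: "g \<in> W" "j \<le> n" "F = convex hull (g ` simplex_vertices j)"
    using proper_face_is_simplex by blast
  then have "j = k" using aff_dim_simplex assms(2) by simp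
  then show ?thesis using g by blast
qed

section \<open>Regularity\<close>

text \<open>Apply the adjacent transpositions \<open>j, j + 1, ..., m - 1\<close> in turn. Each of them
  permutes every initial segment with more than \<open>m\<close> points.\<close>

lemma vertex_move:
  assumes j: "j \<le> m" and m: "m < n"
  shows "\<exists>h\<in>W. h (v j) = v m \<and> (\<forall>k. m < k \<longrightarrow> k \<le> n \<longrightarrow> h ` simplex_vertices k = simplex_vertices k)"
  using j
proof (induction rule: inc_induct)
  case base
  show ?case by (rule bexI[of _ id]) (simp_all add: reflection_group.one)
next
  case (step j)
  from step.IH obtain h where h: "h \<in> W" "h (v (Suc j)) = v m"
    "\<And>k. m < k \<Longrightarrow> k \<le> n \<Longrightarrow> h ` simplex_vertices k = simplex_vertices k" by blast
  let ?r = "reflection (a j)"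
  have j: "Suc j < n" "j < n" using step m by simp_all
  have swap: "?r (v j) = v (Suc j)" "?r (v (Suc j)) = v j"
    using v_step[OF j(1)] reflection_reflection[OF root_unit[OF j(2)], of "v j"] by simp_all
  have fixed: "?r (v i) = v i" if "i < n" "i \<noteq> j" "i \<noteq> Suc j" for i
    using v_orth[of i j] that j root_unit[OF j(2)] by (simp add: reflection_unit)
  have "?r ` simplex_vertices k = simplex_vertices k" if "m < k" "k \<le> n" for k
  proof -
    have sub: "?r ` simplex_vertices k \<subseteq> simplex_vertices k"
    proof
      fix y assume "y \<in> ?r ` simplex_vertices k"
      then obtain i where i: "i < k" "y = ?r (v i)" by (auto simp: simplex_vertices_def)
      have "Suc j < k" using step that by simp
      then show "y \<in> simplex_vertices k"
        using i swap fixed[of i] that by (cases "i = j"; cases "i = Suc j") (auto simp: simplex_vertices_def)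
    qed
    then have "?r ` ?r ` simplex_vertices k \<subseteq> ?r ` simplex_vertices k" by (rule image_mono)
    then have "simplex_vertices k \<subseteq> ?r ` simplex_vertices k"
      by (simp add: image_image reflection_reflection root_unit j)
    with sub show ?thesis by blast
  qed
  then have "(h \<circ> ?r) ` simplex_vertices k = simplex_vertices k" if "m < k" "k \<le> n" for k
    using h(3)[OF that] that by (simp only: image_comp[symmetric])
  moreover have "(h \<circ> ?r) (v j) = v m" using swap h by simp
  moreover have "h \<circ> ?r \<in> W" using h j by (intro reflection_group_comp reflection_group_generator)
  ultimately show ?case by blast
qed

text \<open>Going down from the facet, suppose that \<open>g\<close> matches the faces of dimension above
  \<open>m\<close> with the standard ones. The next face omits one vertex \<open>g (v j)\<close> of the simplex above it.
  By \<open>vertex_move\<close> there is a group element that sends \<open>v j\<close> to the omitted vertex \<open>v (m + 1)\<close>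
  of the standard face and preserves the larger standard faces; composing \<open>g\<close> with its inverse
  corrects the flag in dimension \<open>m\<close> without disturbing the faces already matched.\<close>

lemma flag_in_orbit:
  assumes flag: "is_flag P Fs"
  shows "\<exists>g\<in>W. \<forall>k<n. Fs ! k = convex hull (g ` simplex_vertices (Suc k))"
proof -
  have len: "length Fs = n" using flag aff_dim_P by (simp add: is_flag_def)
  have face: "Fs ! k face_of P" "aff_dim (Fs ! k) = int k" if "k < n" for k
    using flag that len by (auto simp: is_flag_def)
  have chain: "Fs ! k \<subseteq> Fs ! Suc k" if "Suc k < n" for k
    using flag that len by (auto simp: is_flag_def)
  have "\<exists>g\<in>W. \<forall>k. m \<le> k \<longrightarrow> k < n \<longrightarrow> Fs ! k = convex hull (g ` simplex_vertices (Suc k))"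
    if "m \<le> n - 1" for m
    using that
  proof (induction rule: inc_induct)
    case base
    have "\<exists>g\<in>W. Fs ! (n - 1) = convex hull (g ` simplex_vertices n)"
      using face_of_aff_dim[OF face(1), of "n - 1" n] face(2)[of "n - 1"] n_pos by simp
    then obtain g where g: "g \<in> W" "Fs ! (n - 1) = convex hull (g ` simplex_vertices n)" by blast
    have "Fs ! k = convex hull (g ` simplex_vertices (Suc k))" if "n - 1 \<le> k" "k < n" for k
    proof -
      have "k = n - 1" "Suc k = n" using that by simp_all
      then show ?thesis using g(2) by simp
    qed
    then show ?case using g(1) by blast
  next
    case (step m)
    then obtain g where g: "g \<in> W"
      "\<And>k. Suc m \<le> k \<Longrightarrow> k < n \<Longrightarrow> Fs ! k = convex hull (g ` simplex_vertices (Suc k))" by blast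
    have m: "Suc m < n" using step by simp
    have "\<exists>g'\<in>W. Fs ! m = convex hull (g' ` simplex_vertices (Suc m))"
      using face_of_aff_dim[OF face(1), of m "Suc m"] face(2)[of m] m by simp
    then obtain g' where g': "g' \<in> W" "Fs ! m = convex hull (g' ` simplex_vertices (Suc m))" by blast
    let ?S = "simplex_vertices (Suc (Suc m))"
    have S: "?S \<subseteq> V" "g' ` simplex_vertices (Suc m) \<subseteq> V" "g ` ?S \<subseteq> V"
      using simplex_vertices_subset g g' m W_image_subset_V by auto
    have "convex hull (g' ` simplex_vertices (Suc m)) \<subseteq> convex hull (g ` ?S)"
      using chain[OF m] g(2)[of "Suc m"] g' m by simp
    then have sub: "g' ` simplex_vertices (Suc m) \<subseteq> g ` ?S"
      using convex_hull_subset_V_iff S by blast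
    have card: "card (g' ` simplex_vertices (Suc m)) = Suc m" "card (g ` ?S) = Suc (Suc m)"
      using m W_inj[OF g(1)] W_inj[OF g'(1)]
      by (simp_all add: card_image card_simplex_vertices inj_on_subset)
    have fin: "finite (g ` ?S)" by (simp add: simplex_vertices_def)
    have "card (g ` ?S - g' ` simplex_vertices (Suc m)) = 1"
      using card sub fin by (simp add: card_Diff_subset finite_subset)
    then obtain y where y: "g ` ?S - g' ` simplex_vertices (Suc m) = {y}"
      by (rule card_1_singletonE)
    then have "y \<in> g ` ?S" by blast
    then obtain j where j: "j \<le> Suc m" "y = g (v j)" by (auto simp: simplex_vertices_def less_Suc_eq_le)
    obtain h where h: "h \<in> W" "h (v j) = v (Suc m)"
      "\<And>k. Suc m < k \<Longrightarrow> k \<le> n \<Longrightarrow> h ` simplex_vertices k = simplex_vertices k"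
      using vertex_move[OF j(1) m] by blast
    from W_inverse[OF h(1)] obtain h' where h': "h' \<in> W" "\<forall>x. h' (h x) = x \<and> h (h' x) = x" ..
    have h'_image: "h' ` simplex_vertices k = simplex_vertices k" if "Suc m < k" "k \<le> n" for k
    proof -
      have "h' ` simplex_vertices k = h' ` (h ` simplex_vertices k)" using h(3)[OF that] by simp
      then show ?thesis using h'(2) by (simp add: image_image)
    qed
    have h'v: "h' (v (Suc m)) = v j" using h(2) h'(2) by metis
    have "(g \<circ> h') ` simplex_vertices (Suc m) = g ` (h' ` (?S - {v (Suc m)}))"
      using v_notin_simplex_vertices[OF m]
      by (simp add: simplex_vertices_Suc[of "Suc m"] image_comp)
    also have "\<dots> = g ` (?S - {v j})"
      using h'_image[of "Suc (Suc m)"] m W_inj[OF h'(1)] h'v by (simp add: image_set_diff)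
    also have "\<dots> = g ` ?S - {y}"
      using W_inj[OF g(1)] j by (simp add: image_set_diff)
    also have "\<dots> = g' ` simplex_vertices (Suc m)" using y sub by blast
    finally have "Fs ! m = convex hull ((g \<circ> h') ` simplex_vertices (Suc m))" using g' by simp
    moreover have "Fs ! k = convex hull ((g \<circ> h') ` simplex_vertices (Suc k))" if "Suc m \<le> k" "k < n" for k
    proof -
      have "(g \<circ> h') ` simplex_vertices (Suc k) = g ` simplex_vertices (Suc k)"
        using h'_image[of "Suc k"] that by (simp only: image_comp[symmetric])
      then show ?thesis using g(2)[OF that] by (simp only:)
    qed
    ultimately have "\<forall>k. m \<le> k \<longrightarrow> k < n \<longrightarrow> Fs ! k = convex hull ((g \<circ> h') ` simplex_vertices (Suc k))"
      by (metis le_eq_less_or_eq Suc_leI)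
    then show ?case using reflection_group_comp[OF g(1) h'(1)] by blast
  qed
  from this[of 0] show ?thesis by simp
qed

lemma regular: "regular_polytope P"
  unfolding regular_polytope_def
proof (intro conjI allI impI)
  show "polytope P" by (simp add: polytope_convex_hull finite_V)
  fix Fs Gs assume "is_flag P Fs \<and> is_flag P Gs"
  then have flags: "is_flag P Fs" "is_flag P Gs" by simp_all
  then have len: "length Fs = n" "length Gs = n" using aff_dim_P by (simp_all add: is_flag_def)
  from flag_in_orbit[OF flags(1)] obtain g where g: "g \<in> W"
    "\<forall>k<n. Fs ! k = convex hull (g ` simplex_vertices (Suc k))" ..
  from flag_in_orbit[OF flags(2)] obtain h where h: "h \<in> W"
    "\<forall>k<n. Gs ! k = convex hull (h ` simplex_vertices (Suc k))" ..
  from W_inverse[OF g(1)] obtain g' where g': "g' \<in> W" "\<forall>x. g' (g x) = x \<and> g (g' x) = x" ..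
  have f: "h \<circ> g' \<in> W" using h g' reflection_group_comp by blast
  have "map (image (h \<circ> g')) Fs = Gs"
  proof (rule nth_equalityI)
    fix k assume "k < length (map (image (h \<circ> g')) Fs)"
    then have k: "k < n" using len by simp
    have "(h \<circ> g') ` (Fs ! k) = convex hull ((h \<circ> g') ` g ` simplex_vertices (Suc k))"
      using g(2) k W_convex_hull[OF f] by simp
    also have "(h \<circ> g') ` g ` simplex_vertices (Suc k) = h ` simplex_vertices (Suc k)"
      using g'(2) by (simp add: image_image)
    finally show "map (image (h \<circ> g')) Fs ! k = Gs ! k" using k len h(2) by simp
  qed (simp add: len)
  moreover have "dist ((h \<circ> g') x) ((h \<circ> g') y) = dist x y" for x y
  proof -
    have "(h \<circ> g') x - (h \<circ> g') y = (h \<circ> g') (x - y)"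
      using linear_diff[OF W_linear[OF f]] by simp
    then show ?thesis
      using orthogonal_transformation_norm[OF W_orthogonal[OF f]] by (simp only: dist_norm)
  qed
  ultimately show "\<exists>f. polytope_symmetry P f \<and> map (image f) Fs = Gs"
    using W_image_P[OF f] unfolding polytope_symmetry_def by blast
qed

section \<open>The Schlaefli symbol\<close>

lemma v_inner_Suc:
  assumes "i < j" "j < n"
  shows "v i \<bullet> v j = v i \<bullet> v (Suc i)"
  using assms
proof (induction j)
  case (Suc j)
  show ?case
  proof (cases "i = j")
    case False
    then have "v i \<bullet> v (Suc j) = v i \<bullet> v j"
      using Suc v_orth[of i j] by (simp add: v_Suc[of j] inner_diff_right)
    then show ?thesis using Suc False by simp
  qed simp
qed simp

text \<open>The group permutes the chain through adjacent transpositions, so all pairs of its points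
  are at the same distance.\<close>

lemma v_inner:
  assumes "i < j" "j < n"
  shows "v i \<bullet> v j = v 0 \<bullet> v 1"
proof -
  have "v i \<bullet> v (Suc i) = v 0 \<bullet> v 1" if "Suc i < n" for i
    using that
  proof (induction i)
    case (Suc i)
    have "v (Suc i) \<bullet> v (Suc (Suc i)) = v i \<bullet> v (Suc (Suc i))"
      using Suc v_orth[of "Suc (Suc i)" i] by (simp add: v_Suc[of i] inner_diff_left inner_commute[of "a i"])
    also have "\<dots> = v i \<bullet> v (Suc i)" using Suc v_inner_Suc[of i "Suc (Suc i)"] by simp
    finally show ?case using Suc by simp
  qed simp
  moreover have "Suc i < n" using assms by simp
  ultimately show ?thesis unfolding v_inner_Suc[OF assms] by blast
qed

lemma v_inner_neq: "i < n \<Longrightarrow> j < n \<Longrightarrow> i \<noteq> j \<Longrightarrow> v i \<bullet> v j = v 0 \<bullet> v 1"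
  using v_inner[of i j] v_inner[of j i] by (cases i j rule: linorder_cases) (simp_all add: inner_commute)

text \<open>A face of dimension at most \<open>n - 1\<close> is a simplex, and \<open>F\<close> is obtained from \<open>G\<close> by
  dropping three vertices.\<close>

lemma schlaefli_simplex:
  assumes k: "Suc (Suc k) < n" and F: "F face_of P" "aff_dim F = int k - 1"
    and G: "G face_of P" "aff_dim G = int k + 2" and FG: "F \<subseteq> G"
  shows "card {H. H face_of P \<and> F \<subseteq> H \<and> H \<subseteq> G \<and> aff_dim H = int k} = 3"
proof -
  let ?S = "simplex_vertices (k + 3)"
  have "\<exists>g\<in>W. G = convex hull (g ` ?S)"
    using face_of_aff_dim[OF G(1), of "k + 3"] G(2) k by simp
  then obtain g where g: "g \<in> W" "G = convex hull (g ` ?S)" by blast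
  have indep: "\<not> affine_dependent (g ` ?S)"
    using k W_inj[OF g(1)] W_aff_dim[OF g(1)]
    by (simp add: affine_independent_iff_card aff_dim_simplex_vertices card_image inj_on_subset card_simplex_vertices)
      (simp add: simplex_vertices_def)
  have card: "card (g ` ?S) = k + 3"
    using k W_inj[OF g(1)] by (simp add: card_image inj_on_subset card_simplex_vertices)
  have "F face_of G" using F(1) FG G(1) face_of_face by blast
  then obtain C where C: "C \<subseteq> g ` ?S" "F = convex hull C"
    using g(2) face_of_convex_hull_affine_independent[OF indep] by blast
  have "card C = k"
    using F(2) affine_independent_subset[OF indep C(1)]
    by (simp add: C(2) aff_dim_convex_hull affine_independent_iff_card)
  moreover have "{H. H face_of P \<and> F \<subseteq> H \<and> H \<subseteq> G \<and> aff_dim H = int k}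
    = {H. H face_of G \<and> F \<subseteq> H \<and> aff_dim H = int k}"
    using face_of_face[OF G(1)] by blast
  ultimately show ?thesis
    using card_simplex_faces_above[OF indep C(1)] by (simp add: g(2) C(2) card)
qed

text \<open>The vertices adjacent to all of \<open>v 0, ..., v (n - 3)\<close>: adjacent points of the chain have the
  inner product \<open>v 0 \<bullet> v 1\<close>.\<close>

definition ridge_link :: "'a set" where
  "ridge_link = {x \<in> V. \<forall>j<n - 2. x \<bullet> v j = v 0 \<bullet> v 1}"

text \<open>By transitivity \<open>F\<close> may be taken to be the standard face on \<open>v 0, ..., v (n - 3)\<close>. A face one
  dimension higher adds a vertex \<open>x\<close>; being an image of a standard simplex it has all its vertices
  pairwise adjacent, so \<open>x\<close> lies in the link. Conversely the assumption on the link turns the standard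
  face on \<open>v 0, ..., v (n - 2)\<close> into the one with any prescribed \<open>x\<close>.\<close>

lemma schlaefli_ridge:
  assumes n: "2 \<le> n"
    and link: "\<And>x. x \<in> ridge_link \<Longrightarrow> \<exists>h\<in>W. (\<forall>j<n - 2. h (v j) = v j) \<and> h (v (n - 2)) = x"
    and F: "F face_of P" "aff_dim F = int n - 3"
  shows "card {H. H face_of P \<and> F \<subseteq> H \<and> aff_dim H = int (n - 2)} = card ridge_link"
proof -
  let ?B = "simplex_vertices (n - 2)" and ?T = "simplex_vertices (n - 1)"
  have n': "n - 2 < n" "Suc (n - 2) = n - 1" "n - 2 \<le> n" "n - 1 \<le> n" using n by simp_all
  have T_eq: "?T = insert (v (n - 2)) ?B" using simplex_vertices_Suc[of "n - 2"] n' by simp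
  have "\<exists>g\<in>W. F = convex hull (g ` ?B)"
    using face_of_aff_dim[OF F(1), of "n - 2"] F(2) n by simp
  then obtain g where g: "g \<in> W" "F = convex hull (g ` ?B)" by blast
  have h_B: "h ` ?B = ?B" if "\<forall>j<n - 2. h (v j) = v j" for h
    using that by (force simp: simplex_vertices_def image_image)
  have link_B: "x \<notin> ?B" if x: "x \<in> ridge_link" for x
  proof
    assume "x \<in> ?B"
    from link[OF x] obtain h where h: "h \<in> W" "\<forall>j<n - 2. h (v j) = v j" "h (v (n - 2)) = x" by blast
    have "h (v (n - 2)) \<in> h ` ?B" using h h_B[of h] \<open>x \<in> ?B\<close> by simp
    then have "v (n - 2) \<in> ?B" using W_inj[OF h(1)] by (simp add: inj_image_mem_iff)
    then show False using v_notin_simplex_vertices n'(1) by blast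
  qed
  have link_V: "ridge_link \<subseteq> V" by (auto simp: ridge_link_def)
  have B_V: "?B \<subseteq> V" and T_V: "?T \<subseteq> V" using simplex_vertices_subset n' by simp_all
  have gB_V: "g ` insert x ?B \<subseteq> V" if "x \<in> ridge_link" for x
    using W_image_subset_V[OF g(1), of "insert x ?B"] that link_V B_V by blast
  have "{H. H face_of P \<and> F \<subseteq> H \<and> aff_dim H = int (n - 2)}
    = (\<lambda>x. convex hull (g ` insert x ?B)) ` ridge_link" (is "?L = ?R")
  proof
    show "?R \<subseteq> ?L"
    proof
      fix H assume "H \<in> ?R"
      then obtain x where x: "x \<in> ridge_link" "H = convex hull (g ` insert x ?B)" by blast
      from link[OF x(1)] obtain h where h: "h \<in> W" "\<forall>j<n - 2. h (v j) = v j" "h (v (n - 2)) = x" by blast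
      have "h ` ?T = insert x ?B" using h(3) h_B[OF h(2)] by (simp only: T_eq image_insert)
      then have H: "H = convex hull ((g \<circ> h) ` ?T)" using x(2) by (simp only: image_comp[symmetric])
      have gh: "g \<circ> h \<in> W" using g h reflection_group_comp by blast
      have "aff_dim H = int (n - 2)" using aff_dim_simplex[OF gh n'(4)] n by (simp add: H)
      moreover have "H face_of P" using simplex_face[OF gh n'(4)] by (simp only: H)
      moreover have "F \<subseteq> H" unfolding g(2) x(2) by (intro hull_mono image_mono) blast
      ultimately show "H \<in> ?L" by blast
    qed
    show "?L \<subseteq> ?R"
    proof
      fix H assume "H \<in> ?L"
      then have H: "H face_of P" "F \<subseteq> H" "aff_dim H = int (n - 2)" by simp_all
      have "\<exists>g'\<in>W. H = convex hull (g' ` ?T)"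
        using face_of_aff_dim[OF H(1), of "n - 1"] H(3) n by simp
      then obtain g' where g': "g' \<in> W" "H = convex hull (g' ` ?T)" by blast
      have V: "g ` ?B \<subseteq> V" "g' ` ?T \<subseteq> V"
        using W_image_subset_V g(1) g'(1) B_V T_V by simp_all
      then have sub: "g ` ?B \<subseteq> g' ` ?T"
        using H(2) convex_hull_subset_V_iff g(2) g'(2) by simp
      have "card (g ` ?B) = n - 2" "card (g' ` ?T) = n - 1"
        using W_inj[OF g(1)] W_inj[OF g'(1)] n'
        by (simp_all add: card_image inj_on_subset card_simplex_vertices)
      then have "card (g' ` ?T - g ` ?B) = 1"
        using sub n by (simp add: card_Diff_subset simplex_vertices_def)
      then obtain y where "g' ` ?T - g ` ?B = {y}" by (rule card_1_singletonE)
      then have y: "g' ` ?T = insert y (g ` ?B)" "y \<notin> g ` ?B" using sub by blast+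
      from W_inverse[OF g(1)] obtain k where k: "k \<in> W" "\<forall>x. k (g x) = x \<and> g (k x) = x" ..
      have "y \<in> V" using y V by blast
      moreover have "k y \<bullet> v j = v 0 \<bullet> v 1" if j: "j < n - 2" for j
      proof -
        have "g (v j) \<in> g' ` ?T" "g (v j) \<noteq> y"
          using y j by (auto simp: simplex_vertices_def)
        moreover have "y \<in> g' ` ?T" using y by blast
        ultimately obtain p q where pq: "p < n - 1" "q < n - 1" "y = g' (v p)" "g (v j) = g' (v q)" "p \<noteq> q"
          unfolding simplex_vertices_def by blast
        have "k y \<bullet> v j = y \<bullet> g (v j)" using W_inner[OF g(1), of "k y" "v j"] k(2) by simp
        also have "\<dots> = v p \<bullet> v q" using W_inner[OF g'(1)] pq by simp
        finally show ?thesis using v_inner_neq[of p q] pq by simp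
      qed
      ultimately have "k y \<in> ridge_link" using W_in_V[OF k(1)] by (simp add: ridge_link_def)
      moreover have "H = convex hull (g ` insert (k y) ?B)" using g'(2) y k(2) by simp
      ultimately show "H \<in> ?R" by blast
    qed
  qed
  moreover have "inj_on (\<lambda>x. convex hull (g ` insert x ?B)) ridge_link"
  proof (rule inj_onI)
    fix x y assume xy: "x \<in> ridge_link" "y \<in> ridge_link"
      "convex hull (g ` insert x ?B) = convex hull (g ` insert y ?B)"
    then have "g ` insert x ?B = g ` insert y ?B"
      using convex_hull_eq_V_iff[OF gB_V[of x] gB_V[of y]] by (simp only:)
    then have "insert x ?B = insert y ?B" by (simp only: inj_image_eq_iff[OF W_inj[OF g(1)]])
    then show "x = y" using link_B xy by blast
  qed
  ultimately show ?thesis by (simp add: card_image)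
qed

lemma schlaefli_symbol:
  assumes n: "2 \<le> n"
    and link: "\<And>x. x \<in> ridge_link \<Longrightarrow> \<exists>h\<in>W. (\<forall>j<n - 2. h (v j) = v j) \<and> h (v (n - 2)) = x"
  shows "has_schlaefli_symbol P (replicate (n - 2) 3 @ [card ridge_link])"
  unfolding has_schlaefli_symbol_def
proof (intro conjI allI impI)
  let ?ps = "replicate (n - 2) 3 @ [card ridge_link]"
  show "aff_dim P = int (length ?ps) + 1" using n by (simp add: aff_dim_P)
  fix k F G
  assume k: "k < length ?ps"
    and "F face_of P \<and> G face_of P \<and> F \<subseteq> G \<and> aff_dim F = int k - 1 \<and> aff_dim G = int k + 2"
  then have FG: "F face_of P" "G face_of P" "F \<subseteq> G" "aff_dim F = int k - 1" "aff_dim G = int k + 2"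
    by simp_all
  show "card {H. H face_of P \<and> F \<subseteq> H \<and> H \<subseteq> G \<and> aff_dim H = int k} = ?ps ! k"
  proof (cases "k < n - 2")
    case True
    then show ?thesis using schlaefli_simplex[of k F G] FG by (simp add: nth_append)
  next
    case False
    then have k': "k = n - 2" using k by simp
    have "G = P"
      using face_of_aff_dim_lt[OF convex_convex_hull FG(2)] FG(5) aff_dim_P k' n by fastforce
    then have "{H. H face_of P \<and> F \<subseteq> H \<and> H \<subseteq> G \<and> aff_dim H = int k}
      = {H. H face_of P \<and> F \<subseteq> H \<and> aff_dim H = int (n - 2)}"
      using k' face_of_imp_subset by blast
    moreover have "aff_dim F = int n - 3" using FG(4) k' n by simp
    ultimately show ?thesis
      using schlaefli_ridge[OF n link FG(1)] k' by (simp add: nth_append)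
  qed
qed

end

section \<open>Arithmetic of the golden ratio\<close>

lemma golden_bounds: "161 / 100 < golden" "golden < 162 / 100"
proof -
  have "222 / 100 < sqrt 5"
    by (rule real_less_rsqrt) (simp add: power2_eq_square)
  moreover have "sqrt 5 < 224 / 100"
    by (rule real_less_lsqrt) (simp_all add: power2_eq_square)
  ultimately show "161 / 100 < golden" "golden < 162 / 100" by (simp_all add: golden_def)
qed

text \<open>Descent: \<open>m\<^sup>2 + m n - n\<^sup>2\<close> is even only if \<open>m\<close> and \<open>n\<close> both are, so a zero can be halved
  forever.\<close>

lemma golden_norm_form_zero:
  fixes m n :: int
  assumes "m * m + m * n = n * n"
  shows "n = 0"
  using assms
proof (induction "nat \<bar>n\<bar>" arbitrary: m n rule: less_induct)
  case less
  have "even m" "even n"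
    using arg_cong[OF less.prems, of even] by auto
  then obtain m' n' where mn: "m = 2 * m'" "n = 2 * n'" by (auto elim!: evenE)
  then have "m' * m' + m' * n' = n' * n'" using less.prems by simp
  then have "nat \<bar>n'\<bar> < nat \<bar>n\<bar> \<Longrightarrow> n' = 0" by (rule less.hyps[rotated])
  then show ?case using mn by fastforce
qed

text \<open>Multiply by the conjugate \<open>m + n - n \<phi>\<close>; the product is the norm form \<open>m\<^sup>2 + m n - n\<^sup>2\<close>.\<close>

lemma golden_independent:
  fixes m n :: int
  assumes "of_int m + of_int n * golden = 0"
  shows "m = 0 \<and> n = 0"
proof -
  have "(of_int m + of_int n * golden) * (of_int m + of_int n - of_int n * golden)
    = of_int m * of_int m + of_int m * of_int n + of_int n * of_int n * (golden - golden * golden)"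
    by (simp add: algebra_simps)
  then have "(of_int (m * m + m * n) :: real) = of_int (n * n)"
    using assms by (simp add: golden_sq)
  then have "n = 0" using golden_norm_form_zero by (simp only: of_int_eq_iff)
  then show ?thesis using assms by simp
qed

lemma golden_eq_iff:
  fixes m n m' n' :: int
  shows "of_int m + of_int n * golden = of_int m' + of_int n' * golden \<longleftrightarrow> m = m' \<and> n = n'"
  using golden_independent[of "m - m'" "n - n'"] by (auto simp: algebra_simps)

text \<open>From \<open>3 (\<pi> / 5) = \<pi> - 2 (\<pi> / 5)\<close> the cosine is a root of \<open>(c + 1) (4 c\<^sup>2 - 2 c - 1)\<close>, and
  \<open>2 c\<close> satisfies the equation of \<open>\<phi>\<close>.\<close>

lemma cos_pi_fifth: "cos (pi / 5) = golden / 2"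
proof -
  define c where "c = cos (pi / 5)"
  have "0 < c" unfolding c_def by (rule cos_gt_zero_pi) (use pi_gt_zero in linarith)+
  have "cos (3 * (pi / 5)) = cos (pi - 2 * (pi / 5))" by (rule arg_cong[of _ _ cos]) simp
  then have "4 * c ^ 3 - 3 * c = - (2 * c\<^sup>2 - 1)"
    by (simp only: cos_pi_minus cos_treble_cos cos_double_cos c_def)
  then have "(c + 1) * (4 * c\<^sup>2 - 2 * c - 1) = 0"
    by (simp add: algebra_simps power2_eq_square power3_eq_cube)
  then have "4 * c\<^sup>2 - 2 * c - 1 = 0" using \<open>0 < c\<close> by simp
  then have "(2 * c - golden) * (2 * c + golden - 1) = 0"
    using golden_sq by (simp add: algebra_simps power2_eq_square)
  then show ?thesis using golden_bounds \<open>0 < c\<close> by (auto simp: c_def)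
qed

section \<open>Coding icosians by eight integers\<close>

text \<open>The code \<open>[p1, q1, ..., p4, q4]\<close> stands for the quaternion with coordinates \<open>(p + q \<phi>) / 2\<close>.
  Codes make the unit icosians finite data on which statements can be checked by rewriting.\<close>

definition half_quat :: "int list \<Rightarrow> quat" where
  "half_quat ys = (1 / 2) *\<^sub>R quat (of_int (ys ! 0) + of_int (ys ! 1) * golden)
    (of_int (ys ! 2) + of_int (ys ! 3) * golden) (of_int (ys ! 4) + of_int (ys ! 5) * golden)
    (of_int (ys ! 6) + of_int (ys ! 7) * golden)"

lemma length_8E:
  assumes "length ys = 8"
  obtains p1 q1 p2 q2 p3 q3 p4 q4 where "ys = [p1, q1, p2, q2, p3, q3, p4, q4]"
  using assms by (auto simp: numeral_eq_Suc length_Suc_conv)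

text \<open>Four times the inner product of two coded quaternions is \<open>inner_re + inner_im \<phi>\<close>. On the diagonal
  \<open>inner_re\<close> is a sum of eight squares.\<close>

fun inner_re :: "int list \<Rightarrow> int list \<Rightarrow> int" where
  "inner_re (p # q # xs) (r # s # ys) = p * r + q * s + inner_re xs ys"
| "inner_re _ _ = 0"

fun inner_im :: "int list \<Rightarrow> int list \<Rightarrow> int" where
  "inner_im (p # q # xs) (r # s # ys) = p * s + q * r + q * s + inner_im xs ys"
| "inner_im _ _ = 0"

lemma golden_mult:
  "(of_int p + of_int q * golden) * (of_int r + of_int s * golden)
    = of_int (p * r + q * s) + of_int (p * s + q * r + q * s) * golden"
proof -
  have "(of_int p + of_int q * golden) * (of_int r + of_int s * golden)
    = of_int (p * r) + of_int (p * s + q * r) * golden + of_int (q * s) * (golden * golden)"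
    by (simp add: algebra_simps)
  then show ?thesis by (simp add: golden_sq algebra_simps)
qed

lemma half_quat_inner:
  assumes "length xs = 8" "length ys = 8"
  shows "half_quat xs \<bullet> half_quat ys = (of_int (inner_re xs ys) + of_int (inner_im xs ys) * golden) / 4"
proof -
  obtain p1 q1 p2 q2 p3 q3 p4 q4 where xs: "xs = [p1, q1, p2, q2, p3, q3, p4, q4]"
    using assms(1) by (rule length_8E)
  obtain r1 s1 r2 s2 r3 s3 r4 s4 where ys: "ys = [r1, s1, r2, s2, r3, s3, r4, s4]"
    using assms(2) by (rule length_8E)
  have "half_quat xs \<bullet> half_quat ys =
    ((of_int p1 + of_int q1 * golden) * (of_int r1 + of_int s1 * golden)
    + (of_int p2 + of_int q2 * golden) * (of_int r2 + of_int s2 * golden)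
    + (of_int p3 + of_int q3 * golden) * (of_int r3 + of_int s3 * golden)
    + (of_int p4 + of_int q4 * golden) * (of_int r4 + of_int s4 * golden)) / 4"
    by (simp add: xs ys half_quat_def inner_vec_def sum_4)
  also have "\<dots> = (of_int (inner_re xs ys) + of_int (inner_im xs ys) * golden) / 4"
    by (simp only: golden_mult) (simp add: xs ys algebra_simps)
  finally show ?thesis .
qed

lemma half_quat_inject:
  assumes "length xs = 8" "length ys = 8" "half_quat xs = half_quat ys"
  shows "xs = ys"
proof -
  obtain p1 q1 p2 q2 p3 q3 p4 q4 where xs: "xs = [p1, q1, p2, q2, p3, q3, p4, q4]"
    using assms(1) by (rule length_8E)
  obtain r1 s1 r2 s2 r3 s3 r4 s4 where ys: "ys = [r1, s1, r2, s2, r3, s3, r4, s4]"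
    using assms(2) by (rule length_8E)
  show ?thesis
    using assms(3) by (simp add: xs ys half_quat_def vec_eq_iff forall_4 golden_eq_iff)
qed

text \<open>The conditions that solving \<open>icosian_comb a b c d = half_quat ys\<close> for \<open>a\<close>, \<open>b\<close>, \<open>c\<close>, \<open>d\<close>
  imposes: \<open>c\<close> and \<open>d\<close> always come out in \<open>\<int>[\<phi>]\<close>, while \<open>a\<close> and \<open>b\<close> require a division by 2.\<close>

fun icosian_parity :: "int list \<Rightarrow> bool" where
  "icosian_parity [p1, q1, p2, q2, p3, q3, p4, q4] \<longleftrightarrow>
      even (p1 + p3 + q3 + q4) \<and> even (q1 + p3 + p4 + q4) \<and>
      even (p2 + q3 + p4 + q4) \<and> even (q2 + p3 + q3 + p4)"
| "icosian_parity _ \<longleftrightarrow> False"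

lemma icosian_comb_half_quat:
  "icosian_comb (of_int a1 + of_int a2 * golden) (of_int b1 + of_int b2 * golden)
     (of_int c1 + of_int c2 * golden) (of_int d1 + of_int d2 * golden)
   = half_quat [2 * a1 + c1 - d1, 2 * a2 + c2 - d2, 2 * b1 + c1 + d2 - d1, 2 * b2 + c2 + d1,
       c1 - d2, c2 - d1 - d2, c1, c2]"
proof -
  have red: "golden * (golden * t) = golden * t + t" for t
    using golden_sq by (simp add: mult.assoc[symmetric] distrib_right)
  show ?thesis
    by (simp add: icosian_comb_eq half_quat_def vec_eq_iff forall_4 field_simps red golden_sq)
qed

lemma icosians_eq: "icosians = half_quat ` {ys. length ys = 8 \<and> icosian_parity ys}"
proof
  show "icosians \<subseteq> half_quat ` {ys. length ys = 8 \<and> icosian_parity ys}"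
  proof
    fix x assume "x \<in> icosians"
    then obtain a b c d where x: "x = icosian_comb a b c d"
      "a \<in> Zphi" "b \<in> Zphi" "c \<in> Zphi" "d \<in> Zphi" by (rule icosiansE)
    then show "x \<in> half_quat ` {ys. length ys = 8 \<and> icosian_parity ys}"
      by (auto simp: Zphi_def icosian_comb_half_quat)
  qed
  show "half_quat ` {ys. length ys = 8 \<and> icosian_parity ys} \<subseteq> icosians"
  proof
    fix x assume "x \<in> half_quat ` {ys. length ys = 8 \<and> icosian_parity ys}"
    then obtain ys where ys': "length ys = 8" "icosian_parity ys" "x = half_quat ys" by blast
    from ys'(1) obtain p1 q1 p2 q2 p3 q3 p4 q4 where ys: "ys = [p1, q1, p2, q2, p3, q3, p4, q4]"
      by (rule length_8E)
    \<comment> \<open>\<open>d\<close> is \<open>(y4 - y3) / \<phi>\<close> for the doubled coordinates \<open>y\<close>, and \<open>1 / \<phi> = \<phi> - 1\<close>.\<close>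
    define d1 d2 where "d1 = q4 - q3 - p4 + p3" and "d2 = p4 - p3"
    have "even (p1 - p4 + d1)" "even (q1 - q4 + d2)" "even (p2 - p4 - d2 + d1)" "even (q2 - q4 - d1)"
      using ys'(2) by (auto simp: ys d1_def d2_def)
    then obtain a1 a2 b1 b2 where
      "p1 - p4 + d1 = 2 * a1" "q1 - q4 + d2 = 2 * a2" "p2 - p4 - d2 + d1 = 2 * b1" "q2 - q4 - d1 = 2 * b2"
      by (metis dvdE)
    then have "ys = [2 * a1 + p4 - d1, 2 * a2 + q4 - d2, 2 * b1 + p4 + d2 - d1, 2 * b2 + q4 + d1,
       p4 - d2, q4 - d1 - d2, p4, q4]"
      by (simp add: ys d1_def d2_def)
    then show "x \<in> icosians"
      unfolding ys'(3) by (simp only: flip: icosian_comb_half_quat)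
        (intro icosiansI; simp add: Zphi_def; blast)
  qed
qed

section \<open>The 120 unit icosians\<close>

text \<open>Depth-first search for the prefixes with square sum \<open>m\<close> that complete \<open>ys\<close> to the code of an
  icosian with vanishing \<open>inner_im\<close>. Testing at the leaves, with the prefix passed down as an argument,
  keeps all intermediate lists short, which matters when the search is run by rewriting.\<close>

fun code_search :: "nat \<Rightarrow> int \<Rightarrow> int list \<Rightarrow> int list list" where
  "code_search 0 m ys = (if m = 0 \<and> icosian_parity ys \<and> inner_im ys ys = 0 then [ys] else [])"
| "code_search (Suc n) m ys =
    concat (map (\<lambda>z. code_search n (m - z * z) (z # ys)) (filter (\<lambda>z. z * z \<le> m) [-2, -1, 0, 1, 2]))"

lemma set_code_search:
  assumes "m \<le> 4"
  shows "zs \<in> set (code_search n m ys) \<longleftrightarrow> (\<exists>xs. length xs = n \<and> (\<Sum>x\<leftarrow>xs. x * x) = m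
    \<and> zs = xs @ ys \<and> icosian_parity zs \<and> inner_im zs zs = 0)"
  using assms
proof (induction n arbitrary: m ys)
  case 0
  then show ?case by auto
next
  case (Suc n)
  define L :: "int list" where "L = [-2, -1, 0, 1, 2]"
  \<comment> \<open>The five candidates in \<open>L\<close> suffice since a square above 4 exceeds the budget.\<close>
  have sq: "z \<in> set L" if "z * z \<le> m" for z :: int
  proof -
    have "z\<^sup>2 \<le> 2\<^sup>2" using that Suc.prems by (simp add: power2_eq_square)
    then have "\<bar>z\<bar> \<le> 2" using abs_le_square_iff[of z 2] by simp
    then show ?thesis by (auto simp: L_def)
  qed
  have "zs \<in> set (code_search (Suc n) m ys) \<longleftrightarrow> (\<exists>z. z * z \<le> m \<and> zs \<in> set (code_search n (m - z * z) (z # ys)))"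
    unfolding code_search.simps L_def[symmetric] using sq by auto
  also have "\<dots> \<longleftrightarrow> (\<exists>z xs. z * z \<le> m \<and> length xs = n \<and> (\<Sum>x\<leftarrow>xs. x * x) = m - z * z
    \<and> zs = xs @ z # ys \<and> icosian_parity zs \<and> inner_im zs zs = 0)"
  proof -
    have "m - z * z \<le> 4" for z using Suc.prems zero_le_square[of z] by linarith
    then show ?thesis by (simp add: Suc.IH)
  qed
  also have "\<dots> \<longleftrightarrow> (\<exists>xs. length xs = Suc n \<and> (\<Sum>x\<leftarrow>xs. x * x) = m
    \<and> zs = xs @ ys \<and> icosian_parity zs \<and> inner_im zs zs = 0)" (is "?L \<longleftrightarrow> ?R")
  proof
    assume ?L
    then obtain z xs where "z * z \<le> m" "length xs = n" "(\<Sum>x\<leftarrow>xs. x * x) = m - z * z"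
      "zs = xs @ z # ys" "icosian_parity zs" "inner_im zs zs = 0" by blast
    then show ?R by (intro exI[of _ "xs @ [z]"]) simp
  next
    assume ?R
    then obtain xs' where xs': "length xs' = Suc n" "(\<Sum>x\<leftarrow>xs'. x * x) = m"
      "zs = xs' @ ys" "icosian_parity zs" "inner_im zs zs = 0" by blast
    then obtain xs z where xs: "xs' = xs @ [z]" by (cases xs' rule: rev_cases) auto
    have "0 \<le> (\<Sum>x\<leftarrow>xs. x * x)" by (rule sum_list_nonneg) auto
    then show ?L using xs' xs by (intro exI[of _ z] exI[of _ xs]) simp
  qed
  finally show ?case .
qed

definition unit_codes :: "int list list" where "unit_codes = code_search 8 4 []"

lemma set_unit_codes:
  "set unit_codes = {ys. length ys = 8 \<and> icosian_parity ys \<and> inner_re ys ys = 4 \<and> inner_im ys ys = 0}"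
proof -
  have "(\<Sum>y\<leftarrow>ys. y * y) = inner_re ys ys" if "length ys = 8" for ys
    using that by (auto elim!: length_8E)
  then show ?thesis by (auto simp: unit_codes_def set_code_search)
qed

lemma length_unit_codes: "ys \<in> set unit_codes \<Longrightarrow> length ys = 8"
  by (simp add: set_unit_codes)

lemma qnorm_eq_inner: "qnorm x = x \<bullet> x"
  by (simp add: qnorm_eq_norm power2_norm_eq_inner)

lemma unit_shell_eq: "unit_shell icosians = half_quat ` set unit_codes"
proof -
  have "qnorm (half_quat ys) = 1 \<longleftrightarrow> inner_re ys ys = 4 \<and> inner_im ys ys = 0" if "length ys = 8" for ys
    using golden_eq_iff[of "inner_re ys ys" "inner_im ys ys" 4 0]
    by (simp add: qnorm_eq_inner half_quat_inner that)
  then show ?thesis by (auto simp: unit_shell_def icosians_eq set_unit_codes)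
qed

lemma inj_on_half_quat: "inj_on half_quat (set unit_codes)"
  using half_quat_inject length_unit_codes by (intro inj_onI) blast

lemma card_unit_shell: "card (unit_shell icosians) = 120"
proof -
  have "distinct unit_codes" "length unit_codes = 120" by code_simp+
  then show ?thesis
    by (simp add: unit_shell_eq card_image inj_on_half_quat distinct_card)
qed

section \<open>Inner products of icosians and the axis shell\<close>

text \<open>The doubled Gram matrix of the basis of the icosians has entries in \<open>\<int>[\<phi>]\<close>.\<close>

lemma icosian_inner_Zphi:
  assumes "x \<in> icosians" "y \<in> icosians"
  shows "2 * (x \<bullet> y) \<in> Zphi"
proof -
  obtain a b c d where x: "x = icosian_comb a b c d"
    and xc: "a \<in> Zphi" "b \<in> Zphi" "c \<in> Zphi" "d \<in> Zphi"
    using assms(1) by (rule icosiansE)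
  obtain a' b' c' d' where y: "y = icosian_comb a' b' c' d'"
    and yc: "a' \<in> Zphi" "b' \<in> Zphi" "c' \<in> Zphi" "d' \<in> Zphi"
    using assms(2) by (rule icosiansE)
  have "2 * (x \<bullet> y) = of_int 2 * (a * a' + b * b' + c * c' + d * d') + (a * c' + c * a')
    + (b * c' + c * b') + (golden - of_int 1) * (b * d' + d * b') - (a * d' + d * a') - (c * d' + d * c')"
  proof -
    have red: "golden * (golden * t) = golden * t + t" for t
      using golden_sq by (simp add: mult.assoc[symmetric] distrib_right)
    show ?thesis
      unfolding x y icosian_comb_eq by (simp add: inner_vec_def sum_4 field_simps red golden_sq)
  qed
  also have "\<dots> \<in> Zphi"
    by (intro Zphi_add Zphi_diff Zphi_mult Zphi_int Zphi_golden xc yc)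
  finally show ?thesis .
qed

text \<open>The norm lies in \<open>\<int>[\<phi>]\<close> because the Gram matrix of the basis has diagonal 1 and
  off-diagonal entries in \<open>\<int>[\<phi>] / 2\<close>. Its coefficient \<open>m\<close> is a quarter of a sum of eight squares.\<close>

lemma icosian_qnorm:
  assumes "x \<in> icosians"
  shows "\<exists>m n :: int. 0 \<le> m \<and> (m = 0 \<longrightarrow> x = 0) \<and> qnorm x = of_int m + of_int n * golden"
proof -
  obtain a b c d where x: "x = icosian_comb a b c d"
    and xc: "a \<in> Zphi" "b \<in> Zphi" "c \<in> Zphi" "d \<in> Zphi"
    using assms(1) by (rule icosiansE)
  have "qnorm x = a * a + b * b + c * c + d * d + a * c + b * c + (golden - of_int 1) * (b * d) - a * d - c * d"
  proof -
    have red: "golden * (golden * t) = golden * t + t" for t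
      using golden_sq by (simp add: mult.assoc[symmetric] distrib_right)
    show ?thesis
      unfolding x icosian_comb_eq by (simp add: qnorm_def power2_eq_square field_simps red golden_sq)
  qed
  also have "\<dots> \<in> Zphi"
    by (intro Zphi_add Zphi_diff Zphi_mult Zphi_int Zphi_golden xc)
  finally obtain m n where mn: "qnorm x = of_int m + of_int n * golden"
    by (auto simp: Zphi_def)
  obtain ys where ys: "length ys = 8" "x = half_quat ys"
    using assms by (auto simp: icosians_eq)
  have "of_int (4 * m) + of_int (4 * n) * golden = of_int (inner_re ys ys) + of_int (inner_im ys ys) * golden"
    using mn half_quat_inner[OF ys(1) ys(1)] by (simp add: qnorm_eq_inner ys(2))
  then have m: "inner_re ys ys = 4 * m" by (simp only: golden_eq_iff)
  obtain p1 q1 p2 q2 p3 q3 p4 q4 where ys_eq: "ys = [p1, q1, p2, q2, p3, q3, p4, q4]"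
    using ys(1) by (rule length_8E)
  have sq: "inner_re ys ys = p1\<^sup>2 + q1\<^sup>2 + p2\<^sup>2 + q2\<^sup>2 + p3\<^sup>2 + q3\<^sup>2 + p4\<^sup>2 + q4\<^sup>2"
    by (simp add: ys_eq power2_eq_square)
  have "0 \<le> inner_re ys ys" unfolding sq by simp
  moreover have "x = 0" if "m = 0"
  proof -
    have "p1\<^sup>2 + q1\<^sup>2 + p2\<^sup>2 + q2\<^sup>2 + p3\<^sup>2 + q3\<^sup>2 + p4\<^sup>2 + q4\<^sup>2 = 0" using m sq that by simp
    then have "p1 = 0 \<and> q1 = 0 \<and> p2 = 0 \<and> q2 = 0 \<and> p3 = 0 \<and> q3 = 0 \<and> p4 = 0 \<and> q4 = 0"
      by (simp add: add_nonneg_eq_0_iff)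
    then show ?thesis by (simp add: ys(2) ys_eq half_quat_def vec_eq_iff forall_4)
  qed
  ultimately show ?thesis using m mn by auto
qed

lemma icosians_zero: "0 \<in> icosians"
  using icosians_diff[OF icosians_one icosians_one] by simp

text \<open>The coefficients \<open>m\<close> and \<open>m'\<close> of the two norms are nonnegative integers with sum 1.\<close>

lemma axis_shell_eq_plane_unit_shell: "axis_shell icosians = plane_unit_shell icosians"
proof
  show "axis_shell icosians \<subseteq> plane_unit_shell icosians"
    by (auto simp: axis_shell_def plane_unit_shell_def unit_shell_def plane_norm_def icosians_zero)
      (simp_all add: qnorm_def)
  show "plane_unit_shell icosians \<subseteq> axis_shell icosians"
  proof
    fix p assume "p \<in> plane_unit_shell icosians"
    then obtain x y where p: "p = (x, y)" "x \<in> icosians" "y \<in> icosians" "qnorm x + qnorm y = 1"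
      by (auto simp: plane_unit_shell_def plane_norm_def)
    obtain m n where m: "0 \<le> m" "m = 0 \<longrightarrow> x = 0" "qnorm x = of_int m + of_int n * golden"
      using icosian_qnorm[OF p(2)] by blast
    obtain m' n' where m': "0 \<le> m'" "m' = 0 \<longrightarrow> y = 0" "qnorm y = of_int m' + of_int n' * golden"
      using icosian_qnorm[OF p(3)] by blast
    have "of_int (m + m') + of_int (n + n') * golden = of_int 1 + of_int 0 * golden"
      using p(4) m(3) m'(3) by (simp add: algebra_simps)
    then have "m + m' = 1" by (simp only: golden_eq_iff)
    then have "m = 0 \<or> m' = 0" using m m' by linarith
    then have "x = 0 \<or> y = 0" using m m' by blast
    then show "p \<in> axis_shell icosians"
      using p by (auto simp: axis_shell_def unit_shell_def qnorm_def)
  qed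
qed

lemma reflection_icosians:
  assumes "\<alpha> \<in> icosians" "x \<in> icosians" "\<alpha> \<bullet> \<alpha> = 1"
  shows "reflection \<alpha> x \<in> icosians"
proof -
  have scale: "t *\<^sub>R y \<in> icosians" if t: "t \<in> Zphi" and "y \<in> icosians" for t y
  proof -
    obtain a b c d where y: "y = icosian_comb a b c d"
      and yc: "a \<in> Zphi" "b \<in> Zphi" "c \<in> Zphi" "d \<in> Zphi"
      using \<open>y \<in> icosians\<close> by (rule icosiansE)
    have "t *\<^sub>R y = icosian_comb (t * a) (t * b) (t * c) (t * d)"
      by (simp add: y icosian_comb_def scaleR_add_right)
    then show ?thesis using t yc by (simp add: icosiansI Zphi_mult)
  qed
  show ?thesis
    unfolding reflection_unit[OF assms(3)]
    by (intro icosians_diff assms scale icosian_inner_Zphi)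
qed

lemma unit_shell_inner: "x \<in> unit_shell icosians \<Longrightarrow> x \<bullet> x = 1"
  by (simp add: unit_shell_def qnorm_eq_inner)

lemma reflection_unit_shell:
  assumes "\<alpha> \<in> unit_shell icosians" "x \<in> unit_shell icosians"
  shows "reflection \<alpha> x \<in> unit_shell icosians"
proof -
  have \<alpha>: "\<alpha> \<bullet> \<alpha> = 1" using assms unit_shell_inner by blast
  have "reflection \<alpha> x \<bullet> reflection \<alpha> x = x \<bullet> x"
    using orthogonal_transformation_reflection[OF \<alpha>] by (simp add: orthogonal_transformation_def)
  then show ?thesis
    using assms reflection_icosians[OF _ _ \<alpha>] by (simp add: unit_shell_def qnorm_eq_inner)
qed

section \<open>The simple roots and the standard facet of the 600-cell\<close>

text \<open>Simple roots \<open>-1\<close>, \<open>(1 + (1 - \<phi>) j + \<phi> k) / 2\<close>, \<open>(-\<phi> i + (\<phi> - 1) j - k) / 2\<close> and \<open>i\<close>,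
  chosen with many zero coordinates.\<close>

definition root_codes :: "int list list" where
  "root_codes = [[-2, 0, 0, 0, 0, 0, 0, 0], [1, 0, 0, 0, 1, -1, 0, 1],
    [0, 0, 0, -1, -1, 1, -1, 0], [0, 0, 2, 0, 0, 0, 0, 0]]"

text \<open>The first vertex is the unit icosian orthogonal to the last three simple roots and on the
  positive side of the first; the others are its successive reflections in the first three.\<close>

definition vertex_codes :: "int list list" where
  "vertex_codes = [[1, -1, 0, 0, 0, 1, 1, 0], [-1, 1, 0, 0, 0, 1, 1, 0],
    [0, 0, 0, 0, 2, 0, 0, 0], [0, 0, 1, 0, 0, 1, -1, 1]]"

text \<open>The partial sums of \<open>vertex_codes\<close>.\<close>

definition weight_codes :: "int list list" where
  "weight_codes = [[1, -1, 0, 0, 0, 1, 1, 0], [0, 0, 0, 0, 0, 2, 2, 0],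
    [0, 0, 0, 0, 2, 2, 2, 0], [0, 0, 1, 0, 2, 3, 1, 1]]"

text \<open>A sufficient test for \<open>m + n \<phi> > 0\<close> in integers, from \<open>1.61 < \<phi> < 1.62\<close>. These bounds are sharp
  enough for all the differences of inner products that occur.\<close>

definition golden_pos :: "int \<Rightarrow> int \<Rightarrow> bool" where
  "golden_pos m n \<longleftrightarrow> 0 < 100 * m + (if 0 \<le> n then 161 else 162) * n"

lemma golden_pos:
  assumes "golden_pos m n"
  shows "0 < of_int m + of_int n * golden"
proof (cases "0 \<le> n")
  case True
  then have "of_int n * (161 / 100) \<le> of_int n * golden"
    using golden_bounds by (intro mult_left_mono) auto
  moreover have "(0::real) < of_int (100 * m + 161 * n)"
    using assms True unfolding golden_pos_def of_int_0_less_iff by simp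
  ultimately show ?thesis by simp
next
  case False
  then have "of_int n * (162 / 100) \<le> of_int n * golden"
    using golden_bounds by (intro mult_left_mono_neg) auto
  moreover have "(0::real) < of_int (100 * m + 162 * n)"
    using assms False unfolding golden_pos_def of_int_0_less_iff by simp
  ultimately show ?thesis by simp
qed

definition below_weight :: "nat \<Rightarrow> int list \<Rightarrow> bool" where
  "below_weight k ys \<longleftrightarrow> golden_pos
    (inner_re (vertex_codes ! 0) (weight_codes ! k) - inner_re ys (weight_codes ! k))
    (inner_im (vertex_codes ! 0) (weight_codes ! k) - inner_im ys (weight_codes ! k))"

definition h4_root :: "nat \<Rightarrow> quat" where "h4_root i = half_quat (root_codes ! i)"
definition h4_vertex :: "nat \<Rightarrow> quat" where "h4_vertex k = half_quat (vertex_codes ! k)"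

lemma less_4: "k < 4 \<longleftrightarrow> k = 0 \<or> k = 1 \<or> k = 2 \<or> k = (3::nat)"
  by auto

lemma root_codes: "i < 4 \<Longrightarrow> length (root_codes ! i) = 8 \<and> root_codes ! i \<in> set unit_codes"
  by (auto simp: less_4 root_codes_def set_unit_codes)

lemma vertex_codes: "k < 4 \<Longrightarrow> length (vertex_codes ! k) = 8 \<and> vertex_codes ! k \<in> set unit_codes"
  by (auto simp: less_4 vertex_codes_def set_unit_codes)

lemma weight_codes: "k < 4 \<Longrightarrow> length (weight_codes ! k) = 8"
  by (auto simp: less_4 weight_codes_def)

lemma h4_root_in: "i < 4 \<Longrightarrow> h4_root i \<in> unit_shell icosians"
  using root_codes by (simp add: h4_root_def unit_shell_eq)

lemma h4_vertex_in: "k < 4 \<Longrightarrow> h4_vertex k \<in> unit_shell icosians"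
  using vertex_codes by (simp add: h4_vertex_def unit_shell_eq)

lemma h4_weight: "k < 4 \<Longrightarrow> (\<Sum>j\<le>k. h4_vertex j) = half_quat (weight_codes ! k)"
  by (unfold less_4, elim disjE)
    (simp_all add: h4_vertex_def vertex_codes_def weight_codes_def half_quat_def
      vec_eq_iff forall_4 numeral_eq_Suc field_simps)

text \<open>A finite check over the 120 codes and the four weights.\<close>

lemma h4_weight_max:
  assumes "k < 4" "x \<in> unit_shell icosians" "x \<notin> h4_vertex ` {..k}"
  shows "x \<bullet> (\<Sum>j\<le>k. h4_vertex j) < h4_vertex 0 \<bullet> (\<Sum>j\<le>k. h4_vertex j)"
proof -
  obtain ys where ys: "ys \<in> set unit_codes" "x = half_quat ys"
    using assms(2) by (auto simp: unit_shell_eq)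
  have table: "\<forall>ys\<in>set unit_codes. \<forall>k\<in>set [0..<4]. ys \<in> set (take (Suc k) vertex_codes) \<or> below_weight k ys"
    by code_simp
  have "ys \<notin> set (take (Suc k) vertex_codes)"
  proof
    assume "ys \<in> set (take (Suc k) vertex_codes)"
    then obtain j where "j < Suc k" "ys = vertex_codes ! j"
      by (auto simp: in_set_conv_nth)
    then show False using assms(3) ys(2) by (auto simp: h4_vertex_def)
  qed
  moreover have "k \<in> set [0..<4]" using assms(1) by simp
  ultimately have "below_weight k ys" using table ys(1) by blast
  then have pos: "0 < of_int (inner_re (vertex_codes ! 0) (weight_codes ! k) - inner_re ys (weight_codes ! k))
    + of_int (inner_im (vertex_codes ! 0) (weight_codes ! k) - inner_im ys (weight_codes ! k)) * golden"
    unfolding below_weight_def by (rule golden_pos)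
  have "h4_vertex 0 \<bullet> half_quat (weight_codes ! k) = (of_int (inner_re (vertex_codes ! 0) (weight_codes ! k))
      + of_int (inner_im (vertex_codes ! 0) (weight_codes ! k)) * golden) / 4"
    unfolding h4_vertex_def using vertex_codes[of 0] weight_codes[OF assms(1)] by (intro half_quat_inner) simp_all
  moreover have "x \<bullet> half_quat (weight_codes ! k) = (of_int (inner_re ys (weight_codes ! k))
      + of_int (inner_im ys (weight_codes ! k)) * golden) / 4"
    unfolding ys(2) using length_unit_codes[OF ys(1)] weight_codes[OF assms(1)] by (rule half_quat_inner)
  ultimately show ?thesis
    unfolding h4_weight[OF assms(1)] using pos by (simp add: algebra_simps)
qed

lemma h4_root_inner:
  "i < 4 \<Longrightarrow> j < 4 \<Longrightarrow> h4_root i \<bullet> h4_root j =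
    (of_int (inner_re (root_codes ! i) (root_codes ! j)) + of_int (inner_im (root_codes ! i) (root_codes ! j)) * golden) / 4"
  using root_codes by (simp add: h4_root_def half_quat_inner)

lemma h4_vertex_root_inner:
  "k < 4 \<Longrightarrow> i < 4 \<Longrightarrow> h4_vertex k \<bullet> h4_root i =
    (of_int (inner_re (vertex_codes ! k) (root_codes ! i)) + of_int (inner_im (vertex_codes ! k) (root_codes ! i)) * golden) / 4"
  using root_codes vertex_codes by (simp add: h4_root_def h4_vertex_def half_quat_inner)

lemma h4_root_gram: "i < 4 \<Longrightarrow> j < 4 \<Longrightarrow> h4_root i \<bullet> h4_root j = - cos (pi / real (H4_matrix i j))"
  by (simp only: h4_root_inner, unfold less_4, elim disjE)
    (simp_all add: root_codes_def H4_matrix_def doubleton_eq_iff cos_pi_fifth cos_60)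

section \<open>The 600-cell and the root system\<close>

interpretation h4: reflection_polytope h4_root 4 "unit_shell icosians" h4_vertex
proof
  show "h4_root i \<bullet> h4_root i = 1" if "i < 4" for i
    using h4_root_in[OF that] by (rule unit_shell_inner)
  show "4 = DIM(quat)" by simp
  show "u = 0" if "\<And>i. i < 4 \<Longrightarrow> u \<bullet> h4_root i = 0" for u
  proof -
    have u: "u \<bullet> h4_root 0 = 0" "u \<bullet> h4_root 1 = 0" "u \<bullet> h4_root 2 = 0" "u \<bullet> h4_root 3 = 0"
      using that by simp_all
    then have "u $ 1 = 0" "u $ 2 = 0"
      by (simp_all add: h4_root_def root_codes_def half_quat_def inner_vec_def sum_4)
    moreover have "u \<bullet> h4_root 1 = (u $ 1 + u $ 3 * (1 - golden) + u $ 4 * golden) / 2"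
      "u \<bullet> h4_root 2 = (u $ 3 * (golden - 1) - u $ 4 - u $ 2 * golden) / 2"
      by (simp_all add: h4_root_def root_codes_def half_quat_def inner_vec_def sum_4 field_simps)
    ultimately have "u $ 1 = 0" "u $ 2 = 0"
      "u $ 3 * (1 - golden) + u $ 4 * golden = 0" "u $ 3 * (golden - 1) - u $ 4 = 0"
      using u by simp_all
    moreover from this have "u $ 4 * (golden - 1) = 0" by (simp add: algebra_simps)
    then have "u $ 4 = 0" using golden_bounds by simp
    ultimately have "u $ 1 = 0 \<and> u $ 2 = 0 \<and> u $ 3 = 0 \<and> u $ 4 = 0"
      using golden_bounds by simp
    then show ?thesis by (simp add: vec_eq_iff forall_4)
  qed
  show "finite (unit_shell icosians)" by (simp add: unit_shell_eq)
  show "x \<bullet> x = 1" if "x \<in> unit_shell icosians" for x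
    using that by (rule unit_shell_inner)
  show "reflection (h4_root i) x \<in> unit_shell icosians" if "x \<in> unit_shell icosians" "i < 4" for x i
    using that by (intro reflection_unit_shell h4_root_in)
  show "h4_vertex k \<in> unit_shell icosians" if "k < 4" for k
    using that by (rule h4_vertex_in)
  show "0 < h4_vertex k \<bullet> h4_root k" if "k < 4" for k
    using that golden_bounds
    by (simp only: h4_vertex_root_inner, unfold less_4, elim disjE)
      (simp_all add: root_codes_def vertex_codes_def)
  show "reflection (h4_root k) (h4_vertex k) = h4_vertex (Suc k)" if "Suc k < 4" for k
  proof -
    have k: "k < 4" "k = 0 \<or> k = 1 \<or> k = 2" using that by auto
    have "reflection (h4_root k) (h4_vertex k) = h4_vertex k - (2 * (h4_vertex k \<bullet> h4_root k)) *\<^sub>R h4_root k"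
      using unit_shell_inner[OF h4_root_in[OF k(1)]] by (rule reflection_unit)
    also have "\<dots> = h4_vertex (Suc k)"
      using k(2) golden_sq
      by (simp only: h4_vertex_root_inner[OF k(1) k(1)], elim disjE)
        (simp_all add: h4_root_def h4_vertex_def root_codes_def vertex_codes_def half_quat_def
          vec_eq_iff forall_4 numeral_eq_Suc field_simps)
    finally show ?thesis .
  qed
  show "h4_vertex k \<bullet> h4_root i = 0" if "k < 4" "i < 4" "k \<noteq> i" "k \<noteq> Suc i" for k i
    using that
    by (simp only: h4_vertex_root_inner, unfold less_4, elim disjE)
      (simp_all add: root_codes_def vertex_codes_def)
  show "x \<bullet> (\<Sum>j\<le>k. h4_vertex j) < h4_vertex 0 \<bullet> (\<Sum>j\<le>k. h4_vertex j)"
    if "k < 4" "x \<in> unit_shell icosians" "x \<notin> h4_vertex ` {..k}" for k x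
    using that by (rule h4_weight_max)
qed

text \<open>The pentagon of vertices adjacent to both ends of the edge between the first two vertices,
  starting at the third one and listed so that each entry is the reflection of its predecessor, in
  the third and the fourth simple root alternately.\<close>

definition link_codes :: "int list list" where
  "link_codes = [[0, 0, 0, 0, 2, 0, 0, 0], [0, 0, 1, 0, 0, 1, -1, 1], [0, 0, -1, 0, 0, 1, -1, 1],
    [0, 0, -1, 1, 1, 0, 0, 1], [0, 0, 1, -1, 1, 0, 0, 1]]"

lemma h4_edge: "h4_vertex 0 \<bullet> h4_vertex 1 = golden / 2"
  unfolding h4_vertex_def using vertex_codes[of 0] vertex_codes[of 1]
  by (subst half_quat_inner) (simp_all add: vertex_codes_def)

lemma h4_link: "h4.ridge_link = half_quat ` set link_codes"
proof -
  have table: "\<forall>ys\<in>set unit_codes. (inner_re ys (vertex_codes ! 0) = 0 \<and> inner_im ys (vertex_codes ! 0) = 2 \<and>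
      inner_re ys (vertex_codes ! 1) = 0 \<and> inner_im ys (vertex_codes ! 1) = 2) = (ys \<in> set link_codes)"
    by code_simp
  have link: "set link_codes \<subseteq> set unit_codes"
    by (simp add: link_codes_def set_unit_codes)
  have iff: "(\<forall>j<2. half_quat ys \<bullet> h4_vertex j = h4_vertex 0 \<bullet> h4_vertex 1) \<longleftrightarrow> ys \<in> set link_codes"
    if ys: "ys \<in> set unit_codes" for ys
  proof -
    have inner_iff: "half_quat ys \<bullet> h4_vertex j = golden / 2 \<longleftrightarrow>
      inner_re ys (vertex_codes ! j) = 0 \<and> inner_im ys (vertex_codes ! j) = 2" if "j < 4" for j
    proof -
      let ?m = "inner_re ys (vertex_codes ! j)" and ?n = "inner_im ys (vertex_codes ! j)"
      have "half_quat ys \<bullet> h4_vertex j = (of_int ?m + of_int ?n * golden) / 4"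
        unfolding h4_vertex_def using vertex_codes[OF that] length_unit_codes[OF ys]
        by (intro half_quat_inner) simp_all
      moreover have "t / 4 = golden / 2 \<longleftrightarrow> t = of_int 0 + of_int 2 * golden" for t by auto
      ultimately show ?thesis by (simp only: golden_eq_iff)
    qed
    have "(\<forall>j<2. Q j) \<longleftrightarrow> Q 0 \<and> Q 1" for Q :: "nat \<Rightarrow> bool"
      by (auto simp: less_2_cases_iff)
    moreover have "(0::nat) < 4" "(1::nat) < 4" by simp_all
    ultimately show ?thesis
      using bspec[OF table ys] by (simp only: h4_edge inner_iff conj_assoc)
  qed
  have "h4.ridge_link = {x \<in> unit_shell icosians. \<forall>j<2. x \<bullet> h4_vertex j = h4_vertex 0 \<bullet> h4_vertex 1}"
    by (simp add: h4.ridge_link_def)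
  also have "\<dots> = half_quat ` {ys \<in> set unit_codes. ys \<in> set link_codes}"
    unfolding unit_shell_eq using iff by blast
  also have "{ys \<in> set unit_codes. ys \<in> set link_codes} = set link_codes"
    using link by blast
  finally show ?thesis .
qed

lemma card_h4_link: "card h4.ridge_link = 5"
proof -
  have "inj_on half_quat (set link_codes)"
    by (rule inj_on_subset[OF inj_on_half_quat]) (simp add: link_codes_def set_unit_codes)
  then show ?thesis by (simp add: h4_link card_image) (simp add: link_codes_def)
qed

text \<open>The last two simple roots are orthogonal to \<open>h4_vertex 0\<close> and \<open>h4_vertex 1\<close>. The
  dihedral group of order 10 that their reflections generate fixes the edge and runs through the pentagon.\<close>

lemma h4_link_orbit:
  assumes "x \<in> h4.ridge_link"
  shows "\<exists>h\<in>h4.W. (\<forall>j<2. h (h4_vertex j) = h4_vertex j) \<and> h (h4_vertex 2) = x"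
proof -
  define stab where "stab h \<longleftrightarrow> h \<in> h4.W \<and> (\<forall>j<2. h (h4_vertex j) = h4_vertex j)" for h
  have one: "stab id" by (simp add: stab_def reflection_group.one)
  have step: "stab (reflection (h4_root i) \<circ> h)" if "stab h" "i = 2 \<or> i = 3" for i h
  proof -
    have "h4_vertex j \<bullet> h4_root i = 0" if "j < 2" for j
      using \<open>i = 2 \<or> i = 3\<close> that by (intro h4.v_orth) auto
    then show ?thesis using that by (auto simp: stab_def reflection_def intro: reflection_group.mult)
  qed
  have refl: "reflection (h4_root i) (half_quat ys) = half_quat zs"
    if "i < 4" "length ys = 8"
      "half_quat zs = half_quat ys - ((of_int (inner_re ys (root_codes ! i))
        + of_int (inner_im ys (root_codes ! i)) * golden) / 2) *\<^sub>R half_quat (root_codes ! i)" for i ys zs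
    using that h4.root_unit[OF that(1)] root_codes[OF that(1)]
    by (simp add: reflection_unit h4_root_def half_quat_inner)
  have refls: "reflection (h4_root 2) (half_quat (link_codes ! 0)) = half_quat (link_codes ! 1)"
    "reflection (h4_root 3) (half_quat (link_codes ! 1)) = half_quat (link_codes ! 2)"
    "reflection (h4_root 2) (half_quat (link_codes ! 2)) = half_quat (link_codes ! 3)"
    "reflection (h4_root 3) (half_quat (link_codes ! 3)) = half_quat (link_codes ! 4)"
    using golden_sq
    by (intro refl; simp add: link_codes_def root_codes_def half_quat_def vec_eq_iff forall_4 field_simps)+
  have "\<exists>h. stab h \<and> h (h4_vertex 2) = half_quat (link_codes ! k)" if "k < 5" for k
    using that
  proof (induction k)
    case 0
    have "id (h4_vertex 2) = half_quat (link_codes ! 0)"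
      by (simp add: h4_vertex_def link_codes_def vertex_codes_def)
    with one show ?case by blast
  next
    case (Suc k)
    then obtain h where h: "stab h" "h (h4_vertex 2) = half_quat (link_codes ! k)" by auto
    define i :: nat where "i = (if even k then 2 else 3)"
    have "k = 0 \<or> k = 1 \<or> k = 2 \<or> k = 3" using Suc.prems by auto
    then have "reflection (h4_root i) (half_quat (link_codes ! k)) = half_quat (link_codes ! Suc k)"
      using refls by (auto simp: i_def link_codes_def)
    moreover have "stab (reflection (h4_root i) \<circ> h)" by (rule step[OF h(1)]) (simp add: i_def)
    moreover have "(reflection (h4_root i) \<circ> h) (h4_vertex 2)
      = reflection (h4_root i) (half_quat (link_codes ! k))"
      using h(2) by simp
    ultimately show ?case by metis
  qed
  moreover obtain k where "k < 5" "x = half_quat (link_codes ! k)"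
  proof -
    obtain ys where ys: "ys \<in> set link_codes" "x = half_quat ys"
      using assms unfolding h4_link by blast
    moreover have "length link_codes = 5" by (simp add: link_codes_def)
    ultimately show ?thesis using that by (metis in_set_conv_nth)
  qed
  ultimately show ?thesis unfolding stab_def by blast
qed

lemma unit_shell_600_cell: "is_600_cell (convex hull (unit_shell icosians))"
proof -
  have "has_schlaefli_symbol (convex hull (unit_shell icosians)) (replicate (4 - 2) 3 @ [card h4.ridge_link])"
    by (rule h4.schlaefli_symbol) (use h4_link_orbit in simp_all)
  then show ?thesis
    using h4.regular by (simp add: is_600_cell_def card_h4_link numeral_2_eq_2)
qed

lemma unit_shell_H4: "H4_root_system (unit_shell icosians)"
  unfolding H4_root_system_def coxeter_root_system_def
  using h4_root_gram h4.V_eq_root_orbit[OF h4_root_in] by blast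

lemma uminus_icosians: "x \<in> icosians \<Longrightarrow> - x \<in> icosians"
  using icosians_diff[OF icosians_zero, of x] by simp

section \<open>The root-shell system on the axes\<close>

text \<open>A reflection in a root of one summand acts on that summand by an icosian reflection and
  fixes the other one pointwise.\<close>

lemma root_shell_axis: "root_shell_system Zphi (axis_shell icosians)"
  unfolding root_shell_system_def
proof (intro conjI ballI)
  show "real_subring Zphi" by (rule real_subring_Zphi)
  show "finite (axis_shell icosians)" by (simp add: axis_shell_def h4.finite_V)
  have minus: "- p \<in> axis_shell icosians" if "p \<in> axis_shell icosians" for p
    using that by (auto simp: axis_shell_def unit_shell_def uminus_icosians qnorm_def)
  then show "axis_shell icosians = uminus ` axis_shell icosians"
    by (force intro: image_eqI[of _ uminus "- _"])
  have unit: "\<alpha> \<bullet> \<alpha> = 1" if "\<alpha> \<in> axis_shell icosians" for \<alpha>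
    using that by (auto simp: axis_shell_def unit_shell_inner)
  then show "(norm \<alpha>)\<^sup>2 = 1" if "\<alpha> \<in> axis_shell icosians" for \<alpha>
    using that by (simp add: power2_norm_eq_inner)
  show "cartan_coeff \<alpha> \<beta> \<in> Zphi" if "\<alpha> \<in> axis_shell icosians" "\<beta> \<in> axis_shell icosians" for \<alpha> \<beta>
  proof -
    have "2 * (\<alpha> \<bullet> \<beta>) \<in> Zphi"
      using that icosian_inner_Zphi Zphi_int[of 0] by (auto simp: axis_shell_def unit_shell_def)
    then show ?thesis using unit[OF that(1)] by (simp add: cartan_coeff_def)
  qed
  show "reflection \<alpha> ` axis_shell icosians = axis_shell icosians" if \<alpha>: "\<alpha> \<in> axis_shell icosians" for \<alpha>
  proof -
    have closed: "reflection \<alpha> p \<in> axis_shell icosians" if "p \<in> axis_shell icosians" for p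
    proof -
      have comp: "reflection \<alpha> p = (fst p - (2 * (p \<bullet> \<alpha>)) *\<^sub>R fst \<alpha>, snd p - (2 * (p \<bullet> \<alpha>)) *\<^sub>R snd \<alpha>)"
        by (simp add: reflection_unit[OF unit[OF \<alpha>]] prod_eq_iff)
      show ?thesis
        using \<alpha> that reflection_unit_shell unfolding comp
        by (auto simp: axis_shell_def reflection_unit unit_shell_inner)
    qed
    have "p \<in> reflection \<alpha> ` axis_shell icosians" if "p \<in> axis_shell icosians" for p
      using closed[OF that] reflection_reflection[OF unit[OF \<alpha>], of p] by (metis image_eqI)
    with closed show ?thesis by blast
  qed
qed

text \<open>Adjacent vertices of the 600-cell have the Cartan coefficient \<open>\<phi>\<close>.\<close>

lemma noncrystallographic_axis: "noncrystallographic (axis_shell icosians)"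
proof -
  let ?\<alpha> = "(h4_vertex 0, 0) :: quat \<times> quat" and ?\<beta> = "(h4_vertex 1, 0) :: quat \<times> quat"
  have "cartan_coeff ?\<alpha> ?\<beta> = golden"
    using h4_edge h4.V_unit[OF h4_vertex_in[of 0]] by (simp add: cartan_coeff_def)
  moreover have "golden \<notin> \<int>"
    using golden_eq_iff[of 0 1 _ 0] by (auto elim!: Ints_cases)
  moreover have "?\<alpha> \<in> axis_shell icosians" "?\<beta> \<in> axis_shell icosians"
    by (simp_all add: axis_shell_def h4_vertex_in)
  ultimately show ?thesis unfolding noncrystallographic_def by metis
qed

lemma card_axis: "card (axis_shell icosians) = 240"
proof -
  have "0 \<notin> unit_shell icosians" by (simp add: unit_shell_def qnorm_def)
  then have "(unit_shell icosians \<times> {0}) \<inter> ({0} \<times> unit_shell icosians) = {}" by auto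
  then show ?thesis
    by (simp add: axis_shell_def card_Un_disjoint h4.finite_V card_cartesian_product card_unit_shell)
qed

lemma convex_hull_axis_union:
  fixes S :: "'a::euclidean_space set" and T :: "'b::euclidean_space set"
  shows "convex hull (S \<times> {0} \<union> {0} \<times> T) = free_sum (convex hull S) (convex hull T)"
proof -
  have "(convex hull S) \<times> {0} = convex hull (S \<times> {0::'b})"
    "{0} \<times> (convex hull T) = convex hull ({0::'a} \<times> T)"
    by (simp_all add: convex_hull_Times)
  then have "(convex hull S) \<times> {0} \<union> {0} \<times> (convex hull T) \<subseteq> convex hull (S \<times> {0} \<union> {0} \<times> T)"
    by (simp add: hull_mono)
  then have "free_sum (convex hull S) (convex hull T) \<subseteq> convex hull (S \<times> {0} \<union> {0} \<times> T)"
    unfolding free_sum_def by (simp add: hull_minimal)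
  moreover have "convex hull (S \<times> {0} \<union> {0} \<times> T) \<subseteq> free_sum (convex hull S) (convex hull T)"
    unfolding free_sum_def by (intro hull_mono) (auto simp: hull_inc)
  ultimately show ?thesis by blast
qed

theorem theorem5p3:
  shows "finite (unit_shell icosians) \<and> card (unit_shell icosians) = 120
    \<and> is_600_cell (convex hull (unit_shell icosians))
    \<and> polytope_vertices (convex hull (unit_shell icosians)) = unit_shell icosians
    \<and> H4_root_system (unit_shell icosians)
    \<and> axis_shell icosians = plane_unit_shell icosians
    \<and> root_shell_system Zphi (axis_shell icosians)
    \<and> noncrystallographic (axis_shell icosians)
    \<and> H4_sum_H4_root_system (axis_shell icosians)
    \<and> card (axis_shell icosians) = 240
    \<and> convex hull (axis_shell icosians)
        = free_sum (convex hull (unit_shell icosians)) (convex hull (unit_shell icosians))"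
proof (intro conjI)
  show "H4_sum_H4_root_system (axis_shell icosians)"
    unfolding H4_sum_H4_root_system_def axis_shell_def using unit_shell_H4 by blast
  show "convex hull (axis_shell icosians)
        = free_sum (convex hull (unit_shell icosians)) (convex hull (unit_shell icosians))"
    unfolding axis_shell_def by (rule convex_hull_axis_union)
qed (rule h4.finite_V card_unit_shell unit_shell_600_cell h4.vertices_P unit_shell_H4
    axis_shell_eq_plane_unit_shell root_shell_axis noncrystallographic_axis card_axis)+

end
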